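(* Let $X=(X_t)_{t\in\mathbb{R}_+}$ be a (càdlàg) Lévy process with characteristic triplet $(\gamma,\sigma,\nu)$, let $\dot X$ be the associated Lévy white noise, and suppose that it has a positive absolute moment, i.e. $\mathbb{E}(|X_1|^\eta)<+\infty$ for some $\eta>0$. Then there is a random tempered distribution $S$, that is, a measurable map from $(\Omega,\mathcal F)$ to $(\mathcal S'(\mathbb{R}),\mathcal B)$, where $\mathcal B$ is the Borel $\sigma$-field for the weak-$*$ topology, such that almost surely, for all $\varphi\in\mathcal S(\mathbb{R})$, $$\langle S,\varphi\rangle=\langle\dot X,\varphi\rangle=-\int_{\mathbb{R}_+}X_t\varphi'(t)\,dt.$$ In addition, the maps $C:\omega\mapsto C(\omega)\in\mathbb{R}_+$ and $p:\omega\mapsto p(\omega)\in\mathbb{N}$ such that for all $\varphi\in\mathcal S(\mathbb{R})$, $$|\langle S,\varphi\rangle|\le C\,\mathcal N_p(\varphi)\quad\text{a.s.}$$ can be chosen to be $\mathcal F$-measurable.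
   Context: $(\Omega,\mathcal F,\mathbb P)$ is a complete probability space. A Lévy process is a real-valued process $(X_t)_{t\in\mathbb{R}_+}$ with $X_0=0$ a.s., stationary independent increments, stochastically continuous; a càdlàg modification is always taken. The characteristic triplet ($\gamma\in\mathbb{R}$, $\sigma\ge0$, $\nu$ a Lévy measure) is taken with respect to the truncation function $\mathbf 1_{|x|\le1}$. The Lévy white noise $\dot X$ is the derivative of $X$ in $\mathcal D'(\mathbb{R})$: $\langle\dot X(\omega),\varphi\rangle=-\int_{\mathbb{R}_+}X_t(\omega)\varphi'(t)\,dt$ for $\varphi\in\mathcal D(\mathbb{R})$; when $\dot X(\omega)\in\mathcal S'(\mathbb{R})$ the pairing extends to $\varphi\in\mathcal S(\mathbb{R})$. $\mathcal S(\mathbb{R})$ is the Schwartz space, with topology given by the norms $\mathcal N_p(\varphi)=\sum_{\alpha,\beta\le p}\sup_{t\in\mathbb{R}}|t^\alpha\varphi^{(\beta)}(t)|$, $p\in\mathbb{N}$ ($\alpha,\beta$ ranging over nonnegative integers); $\mathcal S'(\mathbb{R})$ is its topological dual. *)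

theory Defs
  imports "HOL-Probability.Probability"
begin

definition smooth :: "(real \<Rightarrow> real) \<Rightarrow> bool" where
  "smooth \<phi> \<longleftrightarrow> (\<forall>n t. (deriv ^^ n) \<phi> differentiable (at t))"

definition test_functions :: "(real \<Rightarrow> real) set" where
  "test_functions = {\<phi>. smooth \<phi> \<and> compact (closure {t. \<phi> t \<noteq> 0})}"

definition schwartz_space :: "(real \<Rightarrow> real) set" where
  "schwartz_space =
    {\<phi>. smooth \<phi> \<and> (\<forall>\<alpha> \<beta>. bounded (range (\<lambda>t. t ^ \<alpha> * (deriv ^^ \<beta>) \<phi> t)))}"

definition schwartz_norm :: "nat \<Rightarrow> (real \<Rightarrow> real) \<Rightarrow> real" where
  "schwartz_norm p \<phi> = (\<Sum>\<alpha>\<le>p. \<Sum>\<beta>\<le>p. SUP t. \<bar>t ^ \<alpha> * (deriv ^^ \<beta>) \<phi> t\<bar>)"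

definition schwartz_topology :: "(real \<Rightarrow> real) topology" where
  "schwartz_topology = topology_generated_by
    {{\<psi> \<in> schwartz_space. schwartz_norm p (\<lambda>t. \<psi> t - \<phi> t) < r} | p \<phi> r.
      \<phi> \<in> schwartz_space \<and> 0 < r}"

text \<open>
  Functionals on a set of functions are represented as extensional functions: they take the
  value \<^const>\<open>undefined\<close> outside of that set, so that equality of functionals is
  equality on their domain.
\<close>

definition tempered_distributions :: "((real \<Rightarrow> real) \<Rightarrow> real) set" where
  "tempered_distributions = {T \<in> extensional schwartz_space.
    (\<forall>\<phi>\<in>schwartz_space. \<forall>\<psi>\<in>schwartz_space. \<forall>a b.
       T (\<lambda>t. a * \<phi> t + b * \<psi> t) = a * T \<phi> + b * T \<psi>) \<and>
    continuous_map schwartz_topology euclideanreal T}"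

text \<open>The weak-* topology is the topology of pointwise convergence on the Schwartz space.\<close>

definition weak_star_topology :: "((real \<Rightarrow> real) \<Rightarrow> real) topology" where
  "weak_star_topology = subtopology
    (product_topology (\<lambda>\<phi>. euclideanreal) schwartz_space) tempered_distributions"

definition weak_star_borel :: "((real \<Rightarrow> real) \<Rightarrow> real) measure" where
  "weak_star_borel = sigma (topspace weak_star_topology) {U. openin weak_star_topology U}"

text \<open>
  A functional \<open>U\<close> on the test functions is called tempered if it is the restriction of a
  tempered distribution. As the test functions are dense in the Schwartz space, that tempered
  distribution is then unique, and it extends the pairing with \<open>U\<close> to Schwartz functions.
\<close>

definition is_tempered :: "((real \<Rightarrow> real) \<Rightarrow> real) \<Rightarrow> bool" where
  "is_tempered U \<longleftrightarrow> (\<exists>T\<in>tempered_distributions. restrict T test_functions = U)"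

definition tempered_pairing :: "((real \<Rightarrow> real) \<Rightarrow> real) \<Rightarrow> (real \<Rightarrow> real) \<Rightarrow> real" where
  "tempered_pairing U =
    (THE T. T \<in> tempered_distributions \<and> restrict T test_functions = U)"


definition cadlag :: "(real \<Rightarrow> real) \<Rightarrow> bool" where
  "cadlag x \<longleftrightarrow> (\<forall>t\<ge>0. (x \<longlongrightarrow> x t) (at_right t)) \<and> (\<forall>t>0. \<exists>l. (x \<longlongrightarrow> l) (at_left t))"

text \<open>
  Processes are indexed by all reals for convenience; only the values at nonnegative times
  are ever used. Paths are only required to be cadlag almost surely, which includes the case where
  all of them are.
\<close>

definition levy_process :: "'w measure \<Rightarrow> (real \<Rightarrow> 'w \<Rightarrow> real) \<Rightarrow> bool" where
  "levy_process M X \<longleftrightarrow>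
    (\<forall>t\<ge>0. X t \<in> borel_measurable M) \<and>
    (AE \<omega> in M. X 0 \<omega> = 0) \<and>
    (\<forall>n (t :: nat \<Rightarrow> real). 0 \<le> t 0 \<and> (\<forall>i<n. t i < t (Suc i)) \<longrightarrow>
       prob_space.indep_vars M (\<lambda>_. borel) (\<lambda>i \<omega>. X (t (Suc i)) \<omega> - X (t i) \<omega>) {..<n}) \<and>
    (\<forall>s\<ge>0. \<forall>h\<ge>0. distr M borel (\<lambda>\<omega>. X (s + h) \<omega> - X s \<omega>)
                  = distr M borel (\<lambda>\<omega>. X h \<omega> - X 0 \<omega>)) \<and>
    (\<forall>t\<ge>0. \<forall>\<epsilon>>0.
       ((\<lambda>s. measure M {\<omega> \<in> space M. \<bar>X s \<omega> - X t \<omega>\<bar> > \<epsilon>}) \<longlongrightarrow> 0) (at t within {0..})) \<and>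
    (AE \<omega> in M. cadlag (\<lambda>t. X t \<omega>))"

definition levy_measure :: "real measure \<Rightarrow> bool" where
  "levy_measure \<nu> \<longleftrightarrow> sets \<nu> = sets borel \<and> emeasure \<nu> {0} = 0 \<and>
    (\<integral>\<^sup>+ x. ennreal (min 1 (x\<^sup>2)) \<partial>\<nu>) < \<infinity>"

definition levy_exponent :: "real \<Rightarrow> real \<Rightarrow> real measure \<Rightarrow> real \<Rightarrow> complex" where
  "levy_exponent \<gamma> \<sigma> \<nu> u =
    \<i> * of_real (\<gamma> * u) - of_real (\<sigma>\<^sup>2 * u\<^sup>2 / 2)
    + (CLINT x|\<nu>. iexp (u * x) - 1 - \<i> * of_real (u * x * indicator {y. \<bar>y\<bar> \<le> 1} x))"

text \<open>The triplet is read off the Levy-Khintchine formula; \<open>\<sigma>\<close> is the standard deviation, not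
  the variance, of the Gaussian part.\<close>

definition has_characteristic_triplet ::
  "'w measure \<Rightarrow> (real \<Rightarrow> 'w \<Rightarrow> real) \<Rightarrow> real \<Rightarrow> real \<Rightarrow> real measure \<Rightarrow> bool" where
  "has_characteristic_triplet M X \<gamma> \<sigma> \<nu> \<longleftrightarrow> 0 \<le> \<sigma> \<and> levy_measure \<nu> \<and>
    (\<forall>t\<ge>0. \<forall>u. char (distr M borel (X t)) u = exp (of_real t * levy_exponent \<gamma> \<sigma> \<nu> u))"

definition levy_white_noise :: "(real \<Rightarrow> 'w \<Rightarrow> real) \<Rightarrow> 'w \<Rightarrow> (real \<Rightarrow> real) \<Rightarrow> real" where
  "levy_white_noise X \<omega> =
    restrict (\<lambda>\<phi>. - (LINT t:{0..}|lborel. X t \<omega> * deriv \<phi> t)) test_functions"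

end

theory Submission
  imports Defs "HOL-Computational_Algebra.Polynomial"
begin

text \<open>
  The white noise of a path \<open>x\<close> is a tempered distribution as soon as
  \<open>\<integral>\<^sub>0\<^sup>\<infinity> \<bar>x(t)\<bar> (1 + t)\<^sup>-\<^sup>q dt\<close> is finite for some \<open>q \<ge> 1\<close>, because
  \<open>(1 + t)\<^sup>q \<bar>\<phi>'(t)\<bar>\<close> is bounded by a multiple of the \<open>q\<close>-th Schwartz norm of \<open>\<phi>\<close>
  (\<open>noise_le\<close>, \<open>noise_tempered\<close>). The integral also serves as the random constant \<open>C\<close>, up to a
  numerical factor, while \<open>p\<close> can be taken deterministic.

  The integral is finite because the paths grow at most polynomially. The moment of positive order controls the
  tail of a single increment \<open>X\<^sub>1\<close>; Ottaviani's maximal inequality carries this control over to the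
  oscillation of the path on a unit interval, uniformly in the interval by stationarity
  (\<open>prob_dyadic_osc_le\<close>). With Markov's inequality and the Borel-Cantelli lemma, the oscillation
  over \<open>[n, n + 1]\<close> is almost surely at most polynomial in \<open>n\<close> for large \<open>n\<close>
  (\<open>AE_polynomial_growth\<close>).

  That the distribution-valued map is Borel for the weak-* topology, and not only measurable for
  the cylinder sets, comes from factoring it through a separable space. On paths of mass at most
  \<open>n\<close>, the pairing with any \<open>\<phi>\<close> is a uniform limit of Riemann sums built from the countably many
  integrals of the path over grid cells. Hence the whole distribution depends continuously on this
  random vector of \<open>\<real>\<^sup>\<nat>\<close> (\<open>noise_measurable\<close>).

  Finally, the extended pairing with the noise refers to the tempered extension of a functional
  on test functions. This extension is unique because test functions are dense in the Schwartz
  space (\<open>test_functions_dense\<close>), which is proved with stretched bump functions.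
\<close>

section \<open>Iterated derivatives and smooth functions\<close>

abbreviation nderiv :: "nat \<Rightarrow> (real \<Rightarrow> real) \<Rightarrow> real \<Rightarrow> real" where
  "nderiv n f \<equiv> (deriv ^^ n) f"

lemma nderiv_Suc_deriv: "nderiv (Suc n) f = nderiv n (deriv f)"
  by (metis comp_apply funpow_Suc_right)

lemma smooth_has_derivative:
  "smooth f \<Longrightarrow> (nderiv n f has_real_derivative nderiv (Suc n) f t) (at t)"
  by (simp add: smooth_def DERIV_deriv_iff_real_differentiable)

lemma smooth_DERIV: "smooth f \<Longrightarrow> (f has_real_derivative deriv f t) (at t)"
  using smooth_has_derivative[of f 0] by simp

lemma smooth_continuous_on: "smooth f \<Longrightarrow> continuous_on A (nderiv n f)"
  by (meson DERIV_isCont continuous_at_imp_continuous_on smooth_has_derivative)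

lemma smooth_deriv: "smooth f \<Longrightarrow> smooth (deriv f)"
  by (metis nderiv_Suc_deriv smooth_def)

text \<open>
  Smoothness quantifies over iterates of \<^const>\<open>deriv\<close>, which cannot be computed before
  differentiability is known. Exhibiting the whole tower of derivatives at once settles both.
\<close>

lemma
  assumes "\<And>n t. (F n has_real_derivative F (Suc n) t) (at t)" "f = F 0"
  shows nderiv_eqI: "nderiv n f = F n" and smoothI: "smooth f"
proof -
  show *: "nderiv n f = F n" for n
  proof (induction n)
    case (Suc n)
    then show ?case using DERIV_imp_deriv[OF assms(1)] by auto
  qed (simp add: assms(2))
  show "smooth f"
    unfolding smooth_def * using assms(1) real_differentiable_def by blast
qed

lemma
  assumes "smooth f" "smooth g"
  shows smooth_lincomb: "smooth (\<lambda>t. a * f t + b * g t)"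
    and nderiv_lincomb:
      "nderiv n (\<lambda>t. a * f t + b * g t) = (\<lambda>t. a * nderiv n f t + b * nderiv n g t)"
proof -
  have *: "((\<lambda>t. a * nderiv n f t + b * nderiv n g t) has_real_derivative
      a * nderiv (Suc n) f t + b * nderiv (Suc n) g t) (at t)" for n t
    by (intro DERIV_add DERIV_cmult smooth_has_derivative assms)
  show "smooth (\<lambda>t. a * f t + b * g t)"
    by (rule smoothI[where F = "\<lambda>n t. a * nderiv n f t + b * nderiv n g t"]) (use * in auto)
  show "nderiv n (\<lambda>t. a * f t + b * g t) = (\<lambda>t. a * nderiv n f t + b * nderiv n g t)"
    by (rule nderiv_eqI[where F = "\<lambda>n t. a * nderiv n f t + b * nderiv n g t"]) (use * in auto)
qed

lemma
  assumes "smooth f" "smooth g"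
  shows smooth_diff: "smooth (\<lambda>t. f t - g t)"
    and nderiv_diff: "nderiv n (\<lambda>t. f t - g t) = (\<lambda>t. nderiv n f t - nderiv n g t)"
  using smooth_lincomb[OF assms, of 1 "-1"] nderiv_lincomb[OF assms, of n 1 "-1"] by simp_all

lemma
  assumes "smooth f"
  shows smooth_affine: "smooth (\<lambda>t. f (c * t + d))"
    and nderiv_affine: "nderiv n (\<lambda>t. f (c * t + d)) = (\<lambda>t. c ^ n * nderiv n f (c * t + d))"
proof -
  have *: "((\<lambda>t. c ^ n * nderiv n f (c * t + d)) has_real_derivative
      c ^ Suc n * nderiv (Suc n) f (c * t + d)) (at t)" for n t
    by (rule derivative_eq_intros DERIV_chain2[OF smooth_has_derivative[OF assms]] refl | simp)+
  show "smooth (\<lambda>t. f (c * t + d))"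
    by (rule smoothI[where F = "\<lambda>n t. c ^ n * nderiv n f (c * t + d)"]) (use * in auto)
  show "nderiv n (\<lambda>t. f (c * t + d)) = (\<lambda>t. c ^ n * nderiv n f (c * t + d))"
    by (rule nderiv_eqI[where F = "\<lambda>n t. c ^ n * nderiv n f (c * t + d)"]) (use * in auto)
qed

lemma deriv_smooth_mult:
  assumes "smooth f" "smooth g"
  shows "deriv (\<lambda>t. f t * g t) = (\<lambda>t. deriv f t * g t + f t * deriv g t)"
  using DERIV_imp_deriv[OF DERIV_mult[OF smooth_DERIV[OF assms(1)] smooth_DERIV[OF assms(2)]]]
  by (auto simp: mult.commute)

text \<open>
  The Leibniz sum with its terms left uncollected: each differentiation hits either factor, and the
  two results are added. Unlike the binomial formula, this form passes from order \<open>n\<close> to order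
  \<open>n + 1\<close> by definition.
\<close>

primrec leibniz :: "nat \<Rightarrow> (real \<Rightarrow> real) \<Rightarrow> (real \<Rightarrow> real) \<Rightarrow> real \<Rightarrow> real" where
  "leibniz 0 f g = (\<lambda>t. f t * g t)"
| "leibniz (Suc n) f g = (\<lambda>t. leibniz n (deriv f) g t + leibniz n f (deriv g) t)"

lemma smooth_mult:
  assumes "smooth f" "smooth g"
  shows "smooth (\<lambda>t. f t * g t)"
proof -
  have "(leibniz n f g has_real_derivative leibniz (Suc n) f g t) (at t)"
    if "smooth f" "smooth g" for n t
    using that
  proof (induction n arbitrary: f g)
    case 0
    then show ?case
      using DERIV_mult[OF smooth_DERIV[of f t] smooth_DERIV[of g t]] by (simp add: mult.commute)
  next
    case (Suc n)
    have "(leibniz (Suc n) f g has_real_derivative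
        leibniz (Suc n) (deriv f) g t + leibniz (Suc n) f (deriv g) t) (at t)"
      unfolding leibniz.simps(2)[of n f g]
      by (intro DERIV_add Suc.IH Suc.prems smooth_deriv)
    then show ?case by (simp only: leibniz.simps(2)[of "Suc n"])
  qed
  then show ?thesis
    using smoothI[of "\<lambda>n. leibniz n f g"] assms by simp
qed

lemma smooth_const: "smooth (\<lambda>t. c)"
  by (rule smoothI[where F = "\<lambda>n t. if n = 0 then c else 0"]) auto

section \<open>The norms and the topology of the Schwartz space\<close>

lemma schwartz_smooth: "\<phi> \<in> schwartz_space \<Longrightarrow> smooth \<phi>"
  by (simp add: schwartz_space_def)

lemma schwartzI:
  assumes "smooth \<phi>" "\<And>\<alpha> \<beta>. \<exists>B. \<forall>t. \<bar>t ^ \<alpha> * nderiv \<beta> \<phi> t\<bar> \<le> B"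
  shows "\<phi> \<in> schwartz_space"
  using assms unfolding schwartz_space_def bounded_iff by fastforce

lemma schwartzE:
  assumes "\<phi> \<in> schwartz_space"
  obtains B where "0 \<le> B" "\<And>t. \<bar>t ^ \<alpha> * nderiv \<beta> \<phi> t\<bar> \<le> B"
proof -
  obtain B where "\<And>t. \<bar>t ^ \<alpha> * nderiv \<beta> \<phi> t\<bar> \<le> B"
    using assms unfolding schwartz_space_def bounded_iff by fastforce
  then show thesis using that abs_ge_zero order_trans by blast
qed

lemma schwartz_bdd_above:
  "\<phi> \<in> schwartz_space \<Longrightarrow> bdd_above (range (\<lambda>t. \<bar>t ^ \<alpha> * nderiv \<beta> \<phi> t\<bar>))"
  by (rule schwartzE[of \<phi> \<alpha> \<beta>], assumption, rule bdd_aboveI2)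

lemma schwartz_term_upper:
  assumes "\<phi> \<in> schwartz_space"
  shows "\<bar>t ^ \<alpha> * nderiv \<beta> \<phi> t\<bar> \<le> (SUP t. \<bar>t ^ \<alpha> * nderiv \<beta> \<phi> t\<bar>)"
  by (rule cSUP_upper[OF UNIV_I schwartz_bdd_above[OF assms]])

lemma schwartz_lincomb:
  assumes "\<phi> \<in> schwartz_space" "\<psi> \<in> schwartz_space"
  shows "(\<lambda>t. a * \<phi> t + b * \<psi> t) \<in> schwartz_space"
proof (rule schwartzI)
  show "smooth (\<lambda>t. a * \<phi> t + b * \<psi> t)"
    using assms by (simp add: schwartz_smooth smooth_lincomb)
  fix \<alpha> \<beta>
  obtain B where B: "\<And>t. \<bar>t ^ \<alpha> * nderiv \<beta> \<phi> t\<bar> \<le> B" using assms(1) schwartzE by blast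
  obtain D where D: "\<And>t. \<bar>t ^ \<alpha> * nderiv \<beta> \<psi> t\<bar> \<le> D" using assms(2) schwartzE by blast
  have "\<bar>t ^ \<alpha> * nderiv \<beta> (\<lambda>t. a * \<phi> t + b * \<psi> t) t\<bar> \<le> \<bar>a\<bar> * B + \<bar>b\<bar> * D" for t
  proof -
    have "\<bar>t ^ \<alpha> * nderiv \<beta> (\<lambda>t. a * \<phi> t + b * \<psi> t) t\<bar>
        = \<bar>a * (t ^ \<alpha> * nderiv \<beta> \<phi> t) + b * (t ^ \<alpha> * nderiv \<beta> \<psi> t)\<bar>"
      using assms by (simp add: nderiv_lincomb schwartz_smooth algebra_simps)
    also have "\<dots> \<le> \<bar>a\<bar> * \<bar>t ^ \<alpha> * nderiv \<beta> \<phi> t\<bar> + \<bar>b\<bar> * \<bar>t ^ \<alpha> * nderiv \<beta> \<psi> t\<bar>"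
      by (metis abs_mult abs_triangle_ineq)
    also have "\<dots> \<le> \<bar>a\<bar> * B + \<bar>b\<bar> * D"
      by (intro add_mono mult_left_mono B D) auto
    finally show ?thesis .
  qed
  then show "\<exists>B. \<forall>t. \<bar>t ^ \<alpha> * nderiv \<beta> (\<lambda>t. a * \<phi> t + b * \<psi> t) t\<bar> \<le> B" by blast
qed

lemma schwartz_diff:
  "\<phi> \<in> schwartz_space \<Longrightarrow> \<psi> \<in> schwartz_space \<Longrightarrow> (\<lambda>t. \<phi> t - \<psi> t) \<in> schwartz_space"
  using schwartz_lincomb[of \<phi> \<psi> 1 "-1"] by simp

lemma nderiv_zero: "nderiv n (\<lambda>t. 0) = (\<lambda>t. 0)"
  by (rule nderiv_eqI[where F = "\<lambda>n t. 0"]) auto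

lemma schwartz_term_nonneg:
  "\<phi> \<in> schwartz_space \<Longrightarrow> 0 \<le> (SUP t. \<bar>t ^ \<alpha> * nderiv \<beta> \<phi> t\<bar>)"
  by (rule cSUP_upper2[OF schwartz_bdd_above, of _ 0]) auto

lemma schwartz_norm_nonneg: "\<phi> \<in> schwartz_space \<Longrightarrow> 0 \<le> schwartz_norm p \<phi>"
  unfolding schwartz_norm_def by (intro sum_nonneg schwartz_term_nonneg)

lemma schwartz_norm_mono:
  assumes "\<phi> \<in> schwartz_space" "p \<le> q"
  shows "schwartz_norm p \<phi> \<le> schwartz_norm q \<phi>"
proof -
  have "schwartz_norm p \<phi> \<le> (\<Sum>\<alpha>\<le>p. \<Sum>\<beta>\<le>q. SUP t. \<bar>t ^ \<alpha> * nderiv \<beta> \<phi> t\<bar>)"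
    unfolding schwartz_norm_def
    by (intro sum_mono sum_mono2 schwartz_term_nonneg assms) (use assms in auto)
  also have "\<dots> \<le> schwartz_norm q \<phi>"
    unfolding schwartz_norm_def
    by (intro sum_mono2 sum_nonneg schwartz_term_nonneg assms) (use assms in auto)
  finally show ?thesis .
qed

lemma schwartz_le_norm:
  assumes "\<phi> \<in> schwartz_space" "\<alpha> \<le> p" "\<beta> \<le> p"
  shows "\<bar>t ^ \<alpha> * nderiv \<beta> \<phi> t\<bar> \<le> schwartz_norm p \<phi>"
proof -
  have "\<bar>t ^ \<alpha> * nderiv \<beta> \<phi> t\<bar> \<le> (SUP t. \<bar>t ^ \<alpha> * nderiv \<beta> \<phi> t\<bar>)"
    by (rule schwartz_term_upper[OF assms(1)])
  also have "\<dots> \<le> (\<Sum>\<beta>\<le>p. SUP t. \<bar>t ^ \<alpha> * nderiv \<beta> \<phi> t\<bar>)"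
    by (rule member_le_sum) (use assms schwartz_term_nonneg in auto)
  also have "\<dots> \<le> schwartz_norm p \<phi>"
    unfolding schwartz_norm_def
    by (rule member_le_sum[where f = "\<lambda>\<alpha>. \<Sum>\<beta>\<le>p. SUP t. \<bar>t ^ \<alpha> * nderiv \<beta> \<phi> t\<bar>"])
      (use assms in \<open>auto intro!: sum_nonneg schwartz_term_nonneg\<close>)
  finally show ?thesis .
qed

lemma schwartz_norm_le:
  assumes "\<And>\<alpha> \<beta> t. \<alpha> \<le> p \<Longrightarrow> \<beta> \<le> p \<Longrightarrow> \<bar>t ^ \<alpha> * nderiv \<beta> \<phi> t\<bar> \<le> B \<alpha> \<beta>"
  shows "schwartz_norm p \<phi> \<le> (\<Sum>\<alpha>\<le>p. \<Sum>\<beta>\<le>p. B \<alpha> \<beta>)"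
  unfolding schwartz_norm_def
  by (intro sum_mono cSUP_least) (use assms in auto)

lemma schwartz_norm_zero: "schwartz_norm p (\<lambda>t. 0) = 0"
  by (simp add: schwartz_norm_def nderiv_zero)

lemma schwartz_norm_triangle:
  assumes "\<phi> \<in> schwartz_space" "\<xi> \<in> schwartz_space" "\<psi> \<in> schwartz_space"
  shows "schwartz_norm p (\<lambda>t. \<psi> t - \<xi> t)
    \<le> schwartz_norm p (\<lambda>t. \<psi> t - \<phi> t) + schwartz_norm p (\<lambda>t. \<phi> t - \<xi> t)"
proof -
  have "(SUP t. \<bar>t ^ \<alpha> * nderiv \<beta> (\<lambda>t. \<psi> t - \<xi> t) t\<bar>)
      \<le> (SUP t. \<bar>t ^ \<alpha> * nderiv \<beta> (\<lambda>t. \<psi> t - \<phi> t) t\<bar>)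
        + (SUP t. \<bar>t ^ \<alpha> * nderiv \<beta> (\<lambda>t. \<phi> t - \<xi> t) t\<bar>)" for \<alpha> \<beta>
  proof (rule cSUP_least)
    fix t :: real
    have "\<bar>t ^ \<alpha> * nderiv \<beta> (\<lambda>t. \<psi> t - \<xi> t) t\<bar>
        = \<bar>t ^ \<alpha> * nderiv \<beta> (\<lambda>t. \<psi> t - \<phi> t) t + t ^ \<alpha> * nderiv \<beta> (\<lambda>t. \<phi> t - \<xi> t) t\<bar>"
      using assms by (simp add: nderiv_diff schwartz_smooth algebra_simps)
    also have "\<dots> \<le> \<bar>t ^ \<alpha> * nderiv \<beta> (\<lambda>t. \<psi> t - \<phi> t) t\<bar> + \<bar>t ^ \<alpha> * nderiv \<beta> (\<lambda>t. \<phi> t - \<xi> t) t\<bar>"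
      by (rule abs_triangle_ineq)
    also have "\<dots> \<le> (SUP t. \<bar>t ^ \<alpha> * nderiv \<beta> (\<lambda>t. \<psi> t - \<phi> t) t\<bar>)
        + (SUP t. \<bar>t ^ \<alpha> * nderiv \<beta> (\<lambda>t. \<phi> t - \<xi> t) t\<bar>)"
      by (rule add_mono[OF schwartz_term_upper[OF schwartz_diff[OF assms(3,1)]]
        schwartz_term_upper[OF schwartz_diff[OF assms(1,2)]]])
    finally show "\<bar>t ^ \<alpha> * nderiv \<beta> (\<lambda>t. \<psi> t - \<xi> t) t\<bar> \<le> \<dots>" .
  qed auto
  then show ?thesis
    unfolding schwartz_norm_def sum.distrib[symmetric] by (intro sum_mono)
qed

lemma topspace_schwartz: "topspace schwartz_topology = schwartz_space"
proof -
  have "\<phi> \<in> \<Union> {{\<psi> \<in> schwartz_space. schwartz_norm p (\<lambda>t. \<psi> t - \<phi> t) < r} | p \<phi> r.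
      \<phi> \<in> schwartz_space \<and> 0 < r}" if "\<phi> \<in> schwartz_space" for \<phi>
  proof (rule UnionI)
    show "{\<psi> \<in> schwartz_space. schwartz_norm 0 (\<lambda>t. \<psi> t - \<phi> t) < 1} \<in>
      {{\<psi> \<in> schwartz_space. schwartz_norm p (\<lambda>t. \<psi> t - \<phi> t) < r} | p \<phi> r.
      \<phi> \<in> schwartz_space \<and> 0 < r}"
      using that zero_less_one by blast
  qed (use that in \<open>simp add: schwartz_norm_zero\<close>)
  then show ?thesis
    unfolding schwartz_topology_def topology_generated_by_topspace by blast
qed

text \<open>
  The subbasic balls already behave like a base: the norms increase with their index, so two balls
  around a common centre contain a third, and the triangle inequality recentres a ball.
\<close>

lemma openin_schwartz_iff:
  "openin schwartz_topology U \<longleftrightarrow> U \<subseteq> schwartz_space \<and>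
    (\<forall>\<phi>\<in>U. \<exists>p r. 0 < r \<and> {\<psi> \<in> schwartz_space. schwartz_norm p (\<lambda>t. \<psi> t - \<phi> t) < r} \<subseteq> U)"
  (is "_ \<longleftrightarrow> _ \<and> (\<forall>\<phi>\<in>U. ?nbhd \<phi> U)")
proof safe
  fix \<phi> assume U: "openin schwartz_topology U" and "\<phi> \<in> U"
  from U have "generate_topology_on {{\<psi> \<in> schwartz_space. schwartz_norm p (\<lambda>t. \<psi> t - \<phi> t) < r} | p \<phi> r.
      \<phi> \<in> schwartz_space \<and> 0 < r} U"
    unfolding schwartz_topology_def openin_topology_generated_by_iff .
  then show "?nbhd \<phi> U"
    using \<open>\<phi> \<in> U\<close>
  proof (induction arbitrary: \<phi>)
    case (Int a b)
    obtain p r where a: "0 < r" "{\<psi> \<in> schwartz_space. schwartz_norm p (\<lambda>t. \<psi> t - \<phi> t) < r} \<subseteq> a"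
      using Int.IH(1) Int.prems by blast
    obtain q s where b: "0 < s" "{\<psi> \<in> schwartz_space. schwartz_norm q (\<lambda>t. \<psi> t - \<phi> t) < s} \<subseteq> b"
      using Int.IH(2) Int.prems by blast
    have "openin schwartz_topology a"
      unfolding schwartz_topology_def openin_topology_generated_by_iff by (rule Int.hyps)
    then have "\<phi> \<in> schwartz_space"
      using Int.prems openin_subset topspace_schwartz by blast
    have "{\<psi> \<in> schwartz_space. schwartz_norm (max p q) (\<lambda>t. \<psi> t - \<phi> t) < min r s} \<subseteq> a \<inter> b"
    proof safe
      fix \<psi> assume \<psi>: "\<psi> \<in> schwartz_space" "schwartz_norm (max p q) (\<lambda>t. \<psi> t - \<phi> t) < min r s"
      have d: "(\<lambda>t. \<psi> t - \<phi> t) \<in> schwartz_space"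
        using \<psi>(1) \<open>\<phi> \<in> schwartz_space\<close> by (rule schwartz_diff)
      show "\<psi> \<in> a" using a(2) \<psi> schwartz_norm_mono[OF d, of p "max p q"] by force
      show "\<psi> \<in> b" using b(2) \<psi> schwartz_norm_mono[OF d, of q "max p q"] by force
    qed
    moreover have "0 < min r s" using a b by simp
    ultimately show ?case by blast
  next
    case (UN K)
    then obtain k where k: "k \<in> K" "\<phi> \<in> k" by blast
    then obtain p r where "0 < r" "{\<psi> \<in> schwartz_space. schwartz_norm p (\<lambda>t. \<psi> t - \<phi> t) < r} \<subseteq> k"
      using UN.IH[OF k] by blast
    moreover have "k \<subseteq> \<Union> K" using k by blast
    ultimately show ?case by (meson order_trans)
  next
    case (Basis s)
    then obtain p \<phi>0 r0 where s: "s = {\<psi> \<in> schwartz_space. schwartz_norm p (\<lambda>t. \<psi> t - \<phi>0 t) < r0}"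
        "\<phi>0 \<in> schwartz_space" by blast
    then have \<phi>: "\<phi> \<in> schwartz_space" "schwartz_norm p (\<lambda>t. \<phi> t - \<phi>0 t) < r0"
      using Basis.prems by auto
    have "{\<psi> \<in> schwartz_space. schwartz_norm p (\<lambda>t. \<psi> t - \<phi> t)
        < r0 - schwartz_norm p (\<lambda>t. \<phi> t - \<phi>0 t)} \<subseteq> s"
    proof safe
      fix \<psi> assume "\<psi> \<in> schwartz_space"
        "schwartz_norm p (\<lambda>t. \<psi> t - \<phi> t) < r0 - schwartz_norm p (\<lambda>t. \<phi> t - \<phi>0 t)"
      then show "\<psi> \<in> s"
        using schwartz_norm_triangle[OF \<phi>(1) s(2), of \<psi> p] by (simp add: s(1))
    qed
    moreover have "0 < r0 - schwartz_norm p (\<lambda>t. \<phi> t - \<phi>0 t)" using \<phi>(2) by simp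
    ultimately show ?case by blast
  qed auto
next
  fix \<phi> assume "openin schwartz_topology U" "\<phi> \<in> U"
  then show "\<phi> \<in> schwartz_space" using openin_subset topspace_schwartz by blast
next
  assume sub: "U \<subseteq> schwartz_space" and *: "\<forall>\<phi>\<in>U. ?nbhd \<phi> U"
  have "\<exists>V. openin schwartz_topology V \<and> \<phi> \<in> V \<and> V \<subseteq> U" if "\<phi> \<in> U" for \<phi>
  proof -
    obtain p r where r: "0 < r" "{\<psi> \<in> schwartz_space. schwartz_norm p (\<lambda>t. \<psi> t - \<phi> t) < r} \<subseteq> U" (is "?V \<subseteq> U")
      using * \<open>\<phi> \<in> U\<close> by blast
    have "openin schwartz_topology ?V"
      unfolding schwartz_topology_def using r sub that by (intro topology_generated_by_Basis) blast
    moreover have "\<phi> \<in> ?V" using sub that r by (auto simp: schwartz_norm_zero)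
    ultimately show ?thesis using r by blast
  qed
  then show "openin schwartz_topology U"
    by (intro iffD2[OF openin_subopen] ballI)
qed

lemma tempered_distributionI:
  assumes ext: "T \<in> extensional schwartz_space"
    and lin: "\<And>\<phi> \<psi> a b. \<phi> \<in> schwartz_space \<Longrightarrow> \<psi> \<in> schwartz_space \<Longrightarrow>
      T (\<lambda>t. a * \<phi> t + b * \<psi> t) = a * T \<phi> + b * T \<psi>"
    and bound: "\<And>\<phi>. \<phi> \<in> schwartz_space \<Longrightarrow> \<bar>T \<phi>\<bar> \<le> C * schwartz_norm p \<phi>"
  shows "T \<in> tempered_distributions"
proof -
  have "openin schwartz_topology {\<phi> \<in> topspace schwartz_topology. T \<phi> \<in> V}" if V: "open V" for V
    unfolding openin_schwartz_iff topspace_schwartz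
  proof (intro conjI ballI)
    fix \<phi> assume "\<phi> \<in> {\<phi> \<in> schwartz_space. T \<phi> \<in> V}"
    then have \<phi>: "\<phi> \<in> schwartz_space" "T \<phi> \<in> V" by auto
    obtain e where e: "0 < e" "ball (T \<phi>) e \<subseteq> V" by (rule openE[OF V \<phi>(2)])
    have "T \<psi> \<in> V" if "\<psi> \<in> schwartz_space" "schwartz_norm p (\<lambda>t. \<psi> t - \<phi> t) < e / (\<bar>C\<bar> + 1)" for \<psi>
    proof -
      have n: "0 \<le> schwartz_norm p (\<lambda>t. \<psi> t - \<phi> t)"
        by (rule schwartz_norm_nonneg[OF schwartz_diff[OF that(1) \<phi>(1)]])
      have "T \<psi> - T \<phi> = T (\<lambda>t. \<psi> t - \<phi> t)"
        using lin[OF that(1) \<phi>(1), of 1 "-1"] by simp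
      then have "\<bar>T \<psi> - T \<phi>\<bar> \<le> C * schwartz_norm p (\<lambda>t. \<psi> t - \<phi> t)"
        using bound[OF schwartz_diff[OF that(1) \<phi>(1)]] by simp
      also have "\<dots> \<le> (\<bar>C\<bar> + 1) * schwartz_norm p (\<lambda>t. \<psi> t - \<phi> t)"
        using n by (intro mult_right_mono) auto
      also have "\<dots> < e" using that(2) by (simp add: field_simps)
      finally show ?thesis using e by (auto simp: dist_real_def subset_iff abs_minus_commute)
    qed
    then show "\<exists>p r. 0 < r \<and> {\<psi> \<in> schwartz_space. schwartz_norm p (\<lambda>t. \<psi> t - \<phi> t) < r}
        \<subseteq> {\<phi> \<in> schwartz_space. T \<phi> \<in> V}"
      using e by (intro exI[of _ p] exI[of _ "e / (\<bar>C\<bar> + 1)"]) (auto simp: add_nonneg_pos)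
  qed auto
  then have "continuous_map schwartz_topology euclideanreal T"
    by (simp add: continuous_map)
  then show ?thesis
    unfolding tempered_distributions_def using ext lin by blast
qed

lemma tempered_distribution_tendsto:
  assumes T: "T \<in> tempered_distributions" and \<phi>: "\<phi> \<in> schwartz_space"
    and u: "\<And>n. u n \<in> schwartz_space"
    and lim: "\<And>p. (\<lambda>n. schwartz_norm p (\<lambda>t. u n t - \<phi> t)) \<longlonglongrightarrow> 0"
  shows "(\<lambda>n. T (u n)) \<longlonglongrightarrow> T \<phi>"
proof (rule topological_tendstoI)
  fix V assume V: "open V" "T \<phi> \<in> V"
  have "openin schwartz_topology {\<phi> \<in> topspace schwartz_topology. T \<phi> \<in> V}"
    using openin_continuous_map_preimage[of schwartz_topology euclideanreal T V] T V
    by (simp add: tempered_distributions_def)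
  then have "\<exists>p r. 0 < r \<and> {\<psi> \<in> schwartz_space. schwartz_norm p (\<lambda>t. \<psi> t - \<phi> t) < r}
      \<subseteq> {\<phi> \<in> schwartz_space. T \<phi> \<in> V}"
    unfolding openin_schwartz_iff topspace_schwartz
    by (elim conjE) (erule bspec, use \<phi> V in simp)
  then obtain p r where r: "0 < r" "{\<psi> \<in> schwartz_space. schwartz_norm p (\<lambda>t. \<psi> t - \<phi> t) < r}
      \<subseteq> {\<phi> \<in> schwartz_space. T \<phi> \<in> V}"
    by (elim exE conjE)
  have "eventually (\<lambda>n. schwartz_norm p (\<lambda>t. u n t - \<phi> t) < r) sequentially"
    by (rule order_tendstoD(2)[OF lim r(1)])
  then show "\<forall>\<^sub>F n in sequentially. T (u n) \<in> V"
  proof eventually_elim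
    case (elim n)
    then have "u n \<in> {\<psi> \<in> schwartz_space. schwartz_norm p (\<lambda>t. \<psi> t - \<phi> t) < r}"
      using u[of n] by simp
    then show ?case using r(2) by blast
  qed
qed

section \<open>Density of the test functions\<close>

text \<open>
  The family \<open>p(1/t) exp(-1/t)\<close> on the positive half-line, with \<open>p\<close> a polynomial. It
  contains the classical flat function and is closed under differentiation, so a single computation
  of a derivative yields smoothness.
\<close>

definition exp_flat :: "real poly \<Rightarrow> real \<Rightarrow> real" where
  "exp_flat p t = (if 0 < t then poly p (1 / t) * exp (- 1 / t) else 0)"

lemma poly_exp_tendsto_0:
  "((\<lambda>x. poly p x * exp (- x)) \<longlongrightarrow> (0::real)) at_top"
proof -
  have "((\<lambda>x. \<Sum>i\<le>degree p. coeff p i * (x ^ i / exp x)) \<longlongrightarrow> (\<Sum>i\<le>degree p. coeff p i * 0)) at_top"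
    by (intro tendsto_intros tendsto_power_div_exp_0)
  then show ?thesis
    by (simp add: poly_altdef sum_distrib_right exp_minus divide_inverse mult.assoc)
qed

lemma exp_flat_tendsto_0: "(exp_flat p \<longlongrightarrow> 0) (at 0)"
proof -
  have "((\<lambda>t. poly p (inverse t) * exp (- inverse t)) \<longlongrightarrow> 0) (at_right (0::real))"
    by (rule filterlim_compose[OF poly_exp_tendsto_0 filterlim_inverse_at_top_right])
  then have "(exp_flat p \<longlongrightarrow> 0) (at_right 0)"
    by (rule Lim_transform_eventually)
       (auto simp: eventually_at_right_field exp_flat_def field_simps intro!: exI[of _ 1])
  moreover have "(exp_flat p \<longlongrightarrow> 0) (at_left 0)"
    by (rule Lim_transform_eventually[OF tendsto_const])
       (auto simp: eventually_at_left_field exp_flat_def intro!: exI[of _ "-1"])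
  ultimately show ?thesis by (simp add: filterlim_split_at)
qed

text \<open>
  With \<open>y = 1/t\<close>, differentiating \<open>p(y) exp(-y)\<close> in \<open>t\<close> gives
  \<open>y\<^sup>2 (p(y) - p'(y)) exp(-y)\<close>.
\<close>

definition exp_flat_coeff :: "real poly \<Rightarrow> real poly" where
  "exp_flat_coeff p = [:0, 0, 1:] * (p - pderiv p)"

lemma exp_flat_has_derivative: "(exp_flat p has_real_derivative exp_flat (exp_flat_coeff p) t) (at t)"
proof -
  consider "t < 0" | "t = 0" | "0 < t" by linarith
  then show ?thesis
  proof cases
    case 1
    have "((\<lambda>t. 0) has_real_derivative 0) (at t)" by simp
    then have "(exp_flat p has_real_derivative 0) (at t)"
      by (rule has_field_derivative_transform_within_open[where S = "{..<0}"])
         (use 1 in \<open>auto simp: exp_flat_def\<close>)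
    then show ?thesis using 1 by (simp add: exp_flat_def)
  next
    case 2
    \<comment> \<open>The difference quotient at 0 is again a member of the family, with polynomial \<open>y p(y)\<close>.\<close>
    have "(\<lambda>h. (exp_flat p (0 + h) - exp_flat p 0) / h) = exp_flat ([:0, 1:] * p)"
      by (auto simp: exp_flat_def fun_eq_iff field_simps)
    then show ?thesis
      using exp_flat_tendsto_0[of "[:0, 1:] * p"] 2
      by (simp add: DERIV_def) (simp add: exp_flat_def)
  next
    case 3
    have "((\<lambda>t. poly p (1 / t) * exp (- 1 / t)) has_real_derivative
        poly (exp_flat_coeff p) (1 / t) * exp (- 1 / t)) (at t)"
      using 3 by (auto intro!: derivative_eq_intros DERIV_chain2[OF poly_DERIV]
          simp: exp_flat_coeff_def field_simps power2_eq_square)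
    then have "(exp_flat p has_real_derivative poly (exp_flat_coeff p) (1 / t) * exp (- 1 / t)) (at t)"
      by (rule has_field_derivative_transform_within_open[where S = "{0<..}"])
         (use 3 in \<open>auto simp: exp_flat_def\<close>)
    then show ?thesis using 3 by (simp add: exp_flat_def)
  qed
qed

lemma smooth_exp_flat: "smooth (exp_flat p)"
  by (rule smoothI[where F = "\<lambda>n. exp_flat ((exp_flat_coeff ^^ n) p)"]) (auto intro: exp_flat_has_derivative)

lemma test_functionI:
  assumes "smooth f" "\<And>t. R < \<bar>t\<bar> \<Longrightarrow> f t = 0"
  shows "f \<in> test_functions"
proof -
  have "{t. f t \<noteq> 0} \<subseteq> {-R..R}" using assms(2) by (force simp: not_less[symmetric])
  then have "bounded {t. f t \<noteq> 0}" using bounded_closed_interval bounded_subset by blast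
  then show ?thesis using assms(1) by (simp add: test_functions_def compact_closure)
qed

lemma nderiv_eq_0_outside:
  assumes "t \<notin> closure {t. f t \<noteq> 0}"
  shows "nderiv n f t = 0"
  using assms
proof (induction n arbitrary: t)
  case 0
  then show ?case using closure_subset[of "{t. f t \<noteq> 0}"] by auto
next
  case (Suc n)
  have "((\<lambda>t. 0) has_real_derivative 0) (at t)" by simp
  then have "(nderiv n f has_real_derivative 0) (at t)"
    by (rule has_field_derivative_transform_within_open[where S = "- closure {t. f t \<noteq> 0}"])
      (use Suc in auto)
  then show ?case using DERIV_imp_deriv by simp
qed

lemma test_function_weighted_bound:
  assumes "f \<in> test_functions"
  obtains B where "\<And>t. \<bar>t ^ \<alpha> * nderiv \<beta> f t\<bar> \<le> B"
proof -
  let ?K = "closure {t. f t \<noteq> 0}"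
  have f: "smooth f" "compact ?K" using assms by (auto simp: test_functions_def)
  have "compact ((\<lambda>t. t ^ \<alpha> * nderiv \<beta> f t) ` ?K)"
    by (intro compact_continuous_image continuous_intros smooth_continuous_on f)
  then obtain B where B: "\<And>t. t \<in> ?K \<Longrightarrow> \<bar>t ^ \<alpha> * nderiv \<beta> f t\<bar> \<le> B"
    using compact_imp_bounded[of "(\<lambda>t. t ^ \<alpha> * nderiv \<beta> f t) ` ?K"] unfolding bounded_iff by auto
  have "\<bar>t ^ \<alpha> * nderiv \<beta> f t\<bar> \<le> \<bar>B\<bar>" for t
  proof (cases "t \<in> ?K")
    case False
    then show ?thesis by (simp add: nderiv_eq_0_outside)
  qed (use B abs_ge_self order_trans in blast)
  then show thesis using that by blast
qed

lemma test_functions_subset_schwartz: "test_functions \<subseteq> schwartz_space"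
proof
  fix f assume "f \<in> test_functions"
  then show "f \<in> schwartz_space"
    by (intro schwartzI) (use test_function_weighted_bound test_functions_def in \<open>blast+\<close>)
qed

lemma test_bump_exists:
  obtains b where "b \<in> test_functions" "b 0 = 1"
proof
  \<comment> \<open>The factors vanish for \<open>t \<le> -1\<close> and for \<open>t \<ge> 1\<close>; the constant \<open>exp 1\<close> normalises the value at 0.\<close>
  let ?b = "\<lambda>t. exp_flat [:exp 1:] (1 * t + 1) * exp_flat [:exp 1:] ((-1) * t + 1)"
  have "smooth ?b" by (intro smooth_mult smooth_affine smooth_exp_flat)
  then show "?b \<in> test_functions"
    by (rule test_functionI[where R = 1]) (auto simp: exp_flat_def)
  show "?b 0 = 1" by (simp add: exp_flat_def mult_exp_exp)
qed

text \<open>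
  This replaces the binomial Leibniz formula: in \<open>(h \<phi>)' = h' \<phi> + h \<phi>'\<close> both summands have the same
  form as \<open>h \<phi>\<close>, since the hypothesis on \<open>h\<close> passes to \<open>h'\<close> and \<open>\<phi>'\<close> is again a
  Schwartz function. Hence the order of differentiation can be lowered by induction. The factor
  \<open>1 + \<bar>t\<bar>\<close> in the hypothesis costs one power of \<open>t\<close>, which a Schwartz function can pay.
\<close>

lemma small_multiplier:
  assumes "\<And>n. smooth (h n)"
    and "\<And>k. \<exists>C. \<forall>n t. \<bar>nderiv k (h n) t\<bar> \<le> C * (1 + \<bar>t\<bar>) / real (Suc n)"
    and "\<phi> \<in> schwartz_space"
  shows "\<exists>D. \<forall>n t. \<bar>t ^ \<alpha> * nderiv \<beta> (\<lambda>t. h n t * \<phi> t) t\<bar> \<le> D / real (Suc n)"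
  using assms
proof (induction \<beta> arbitrary: h \<phi>)
  case 0
  obtain C where C: "\<And>n t. \<bar>h n t\<bar> \<le> C * (1 + \<bar>t\<bar>) / real (Suc n)"
    using 0(2)[of 0] by auto
  obtain B where B: "\<And>t. \<bar>t ^ \<alpha> * \<phi> t\<bar> \<le> B"
    using schwartzE[OF 0(3), of \<alpha> 0] by (metis funpow_0)
  obtain B' where B': "\<And>t. \<bar>t ^ Suc \<alpha> * \<phi> t\<bar> \<le> B'"
    using schwartzE[OF 0(3), of "Suc \<alpha>" 0] by (metis funpow_0)
  have "\<bar>t ^ \<alpha> * (h n t * \<phi> t)\<bar> \<le> \<bar>C\<bar> * (B + B') / real (Suc n)" for n t
  proof -
    have "\<bar>t ^ \<alpha> * (h n t * \<phi> t)\<bar> = \<bar>h n t\<bar> * \<bar>t ^ \<alpha> * \<phi> t\<bar>" by (simp add: abs_mult)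
    also have "\<dots> \<le> (\<bar>C\<bar> * (1 + \<bar>t\<bar>) / real (Suc n)) * \<bar>t ^ \<alpha> * \<phi> t\<bar>"
      by (intro mult_right_mono order_trans[OF C] divide_right_mono) auto
    also have "\<dots> = \<bar>C\<bar> * (\<bar>t ^ \<alpha> * \<phi> t\<bar> + \<bar>t ^ Suc \<alpha> * \<phi> t\<bar>) / real (Suc n)"
      by (simp add: abs_mult algebra_simps)
    also have "\<dots> \<le> \<bar>C\<bar> * (B + B') / real (Suc n)"
      by (intro divide_right_mono mult_left_mono add_mono B B') auto
    finally show ?thesis .
  qed
  then show ?case by auto
next
  case (Suc \<beta>)
  let ?u = "\<lambda>n t. deriv (h n) t * \<phi> t" and ?v = "\<lambda>n t. h n t * deriv \<phi> t"
  have \<phi>: "smooth \<phi>" using Suc.prems(3) by (rule schwartz_smooth)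
  have d\<phi>: "deriv \<phi> \<in> schwartz_space"
  proof (rule schwartzI)
    show "\<exists>B. \<forall>t. \<bar>t ^ \<alpha> * nderiv \<beta> (deriv \<phi>) t\<bar> \<le> B" for \<alpha> \<beta>
      using schwartzE[OF Suc.prems(3), of \<alpha> "Suc \<beta>"] unfolding nderiv_Suc_deriv by metis
  qed (intro smooth_deriv \<phi>)
  have "\<exists>D. \<forall>n t. \<bar>t ^ \<alpha> * nderiv \<beta> (?u n) t\<bar> \<le> D / real (Suc n)"
  proof (rule Suc.IH)
    show "\<exists>C. \<forall>n t. \<bar>nderiv k (deriv (h n)) t\<bar> \<le> C * (1 + \<bar>t\<bar>) / real (Suc n)" for k
      using Suc.prems(2)[of "Suc k"] unfolding nderiv_Suc_deriv .
  qed (intro smooth_deriv Suc.prems)+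
  then obtain D where D: "\<And>n t. \<bar>t ^ \<alpha> * nderiv \<beta> (?u n) t\<bar> \<le> D / real (Suc n)" by auto
  have "\<exists>D. \<forall>n t. \<bar>t ^ \<alpha> * nderiv \<beta> (?v n) t\<bar> \<le> D / real (Suc n)"
    by (intro Suc.IH Suc.prems d\<phi>)
  then obtain D' where D': "\<And>n t. \<bar>t ^ \<alpha> * nderiv \<beta> (?v n) t\<bar> \<le> D' / real (Suc n)" by auto
  have "\<bar>t ^ \<alpha> * nderiv (Suc \<beta>) (\<lambda>t. h n t * \<phi> t) t\<bar> \<le> (D + D') / real (Suc n)" for n t
  proof -
    have "nderiv (Suc \<beta>) (\<lambda>t. h n t * \<phi> t) = nderiv \<beta> (\<lambda>t. 1 * ?u n t + 1 * ?v n t)"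
      by (simp only: nderiv_Suc_deriv deriv_smooth_mult[OF Suc.prems(1) \<phi>] mult_1)
    also have "\<dots> = (\<lambda>t. nderiv \<beta> (?u n) t + nderiv \<beta> (?v n) t)"
      using nderiv_lincomb[of "?u n" "?v n" \<beta> 1 1]
      by (simp add: smooth_mult smooth_deriv Suc.prems(1) \<phi>)
    finally have "\<bar>t ^ \<alpha> * nderiv (Suc \<beta>) (\<lambda>t. h n t * \<phi> t) t\<bar>
        = \<bar>t ^ \<alpha> * nderiv \<beta> (?u n) t + t ^ \<alpha> * nderiv \<beta> (?v n) t\<bar>"
      by (simp add: distrib_left)
    also have "\<dots> \<le> D / real (Suc n) + D' / real (Suc n)"
      by (intro order_trans[OF abs_triangle_ineq] add_mono D D')
    finally show ?thesis by (simp add: add_divide_distrib)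
  qed
  then show ?case by blast
qed

text \<open>
  The multipliers to which the preceding lemma is applied. At order 0 the bound is the mean value
  theorem at the origin, where \<open>b\<close> equals 1; at order \<open>k > 0\<close> the chain rule gives a factor \<open>(n + 1)\<^sup>-\<^sup>k\<close>.
\<close>

lemma cutoff_small:
  assumes b: "b \<in> test_functions" "b 0 = 1"
  shows "\<exists>C. \<forall>n t. \<bar>nderiv k (\<lambda>t. b (1 / real (Suc n) * t + 0) - 1) t\<bar> \<le> C * (1 + \<bar>t\<bar>) / real (Suc n)"
proof -
  have sm: "smooth b" using b by (simp add: test_functions_def)
  have sa: "smooth (\<lambda>t. b (c * t + 0))" for c by (rule smooth_affine[OF sm])
  have one: "nderiv k (\<lambda>t. 1) = (\<lambda>t. if k = 0 then 1 else 0)" for k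
    by (rule nderiv_eqI[where F = "\<lambda>n t. if n = 0 then 1 else 0"]) auto
  have eq: "nderiv k (\<lambda>t. b (c * t + 0) - 1) t = c ^ k * nderiv k b (c * t) - (if k = 0 then 1 else 0)" for c t
    by (simp add: nderiv_diff[OF sa smooth_const] nderiv_affine[OF sm] one del: add_0_right)
  show ?thesis
  proof (cases "k = 0")
    case True
    obtain B where B: "\<And>t. \<bar>t ^ 0 * nderiv 1 b t\<bar> \<le> B"
      using test_function_weighted_bound[OF b(1), of 0 1] by metis
    have lip: "\<bar>b s - 1\<bar> \<le> B * \<bar>s\<bar>" for s
    proof -
      have "\<bar>b s - b 0\<bar> \<le> B * \<bar>s - 0\<bar>"
        using field_differentiable_bound[of UNIV b "deriv b" B s 0] B smooth_DERIV[OF sm] by auto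
      then show ?thesis using b(2) by simp
    qed
    have "0 \<le> B" using B[of 0] by auto
    have "\<bar>b (1 / real (Suc n) * t + 0) - 1\<bar> \<le> B * (1 + \<bar>t\<bar>) / real (Suc n)" for n t
    proof -
      have "\<bar>b (1 / real (Suc n) * t + 0) - 1\<bar> \<le> B * \<bar>t\<bar> / real (Suc n)"
        using lip[of "1 / real (Suc n) * t + 0"] by (simp add: abs_mult del: of_nat_Suc)
      also have "\<dots> \<le> B * (1 + \<bar>t\<bar>) / real (Suc n)"
        using \<open>0 \<le> B\<close> by (intro divide_right_mono mult_left_mono) auto
      finally show ?thesis .
    qed
    then show ?thesis using True by auto
  next
    case False
    obtain B where B: "\<And>t. \<bar>t ^ 0 * nderiv k b t\<bar> \<le> B"
      using test_function_weighted_bound[OF b(1), of 0 k] by metis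
    have B0: "0 \<le> B" using B[of 0] by auto
    have "\<bar>nderiv k (\<lambda>t. b (1 / real (Suc n) * t + 0) - 1) t\<bar> \<le> B * (1 + \<bar>t\<bar>) / real (Suc n)" for n t
    proof -
      let ?c = "1 / real (Suc n)"
      have "?c ^ k \<le> ?c ^ 1" using False by (intro power_decreasing) auto
      have "\<bar>nderiv k (\<lambda>t. b (?c * t + 0) - 1) t\<bar> = ?c ^ k * \<bar>nderiv k b (?c * t)\<bar>"
        unfolding eq using False by (simp add: abs_mult)
      also have "\<dots> \<le> ?c ^ 1 * B"
        using B[of "?c * t"] \<open>?c ^ k \<le> ?c ^ 1\<close> by (intro mult_mono) auto
      also have "\<dots> \<le> B * (1 + \<bar>t\<bar>) / real (Suc n)"
        using B0 by (simp add: divide_right_mono mult_left_mono algebra_simps)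
      finally show ?thesis .
    qed
    then show ?thesis by blast
  qed
qed

text \<open>
  Cut \<open>\<phi>\<close> off by a slowly stretched bump; the error is \<open>\<phi>\<close> times the small multiplier above.
\<close>

lemma test_functions_dense:
  assumes "\<phi> \<in> schwartz_space"
  shows "\<exists>u. (\<forall>n. u n \<in> test_functions) \<and>
    (\<forall>p. (\<lambda>n. schwartz_norm p (\<lambda>t. u n t - \<phi> t)) \<longlonglongrightarrow> 0)"
proof -
  obtain b where b: "b \<in> test_functions" "b 0 = 1" by (rule test_bump_exists)
  have sm: "smooth b" using b by (simp add: test_functions_def)
  obtain R where R: "\<And>t. R < \<bar>t\<bar> \<Longrightarrow> b t = 0"
  proof -
    have "bounded {t. b t \<noteq> 0}"
      using b(1) by (auto simp: test_functions_def intro: bounded_subset[OF compact_imp_bounded closure_subset])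
    then obtain a where "\<And>t. b t \<noteq> 0 \<Longrightarrow> \<bar>t\<bar> \<le> a" by (auto simp: bounded_iff)
    then show thesis using that[of a] by (meson not_le)
  qed
  let ?h = "\<lambda>n t. b (1 / real (Suc n) * t + 0) - 1"
  let ?u = "\<lambda>n t. b (1 / real (Suc n) * t + 0) * \<phi> t"
  have u: "?u n \<in> test_functions" for n
  proof (rule test_functionI[where R = "R * real (Suc n)"])
    show "smooth (?u n)"
      by (intro smooth_mult smooth_affine sm schwartz_smooth assms)
    show "?u n t = 0" if "R * real (Suc n) < \<bar>t\<bar>" for t
      using R[of "1 / real (Suc n) * t + 0"] that by (simp add: field_simps)
  qed
  have sh: "smooth (?h n)" for n
    by (rule smooth_diff[OF smooth_affine[OF sm] smooth_const])
  have diff: "(\<lambda>t. ?u n t - \<phi> t) = (\<lambda>t. ?h n t * \<phi> t)" for n by (auto simp: algebra_simps)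
  have lim: "(\<lambda>n. schwartz_norm p (\<lambda>t. ?u n t - \<phi> t)) \<longlonglongrightarrow> 0" for p
  proof -
    have "\<exists>D. \<forall>n t. \<bar>t ^ fst c * nderiv (snd c) (\<lambda>t. ?h n t * \<phi> t) t\<bar> \<le> D / real (Suc n)" for c
    proof (rule small_multiplier)
      show "\<exists>C. \<forall>n t. \<bar>nderiv k (?h n) t\<bar> \<le> C * (1 + \<bar>t\<bar>) / real (Suc n)" for k
        by (rule cutoff_small[OF b])
    qed (fact sh assms)+
    then have "\<forall>c. \<exists>D. \<forall>n t. \<bar>t ^ fst c * nderiv (snd c) (\<lambda>t. ?h n t * \<phi> t) t\<bar> \<le> D / real (Suc n)" ..
    from choice[OF this] obtain E where E: "\<And>c n t.
        \<bar>t ^ fst c * nderiv (snd c) (\<lambda>t. ?h n t * \<phi> t) t\<bar> \<le> E c / real (Suc n)" by blast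
    define D where "D \<alpha> \<beta> = E (\<alpha>, \<beta>)" for \<alpha> \<beta>
    have D: "\<bar>t ^ \<alpha> * nderiv \<beta> (\<lambda>t. ?h n t * \<phi> t) t\<bar> \<le> D \<alpha> \<beta> / real (Suc n)" for \<alpha> \<beta> n t
      using E[of t "(\<alpha>, \<beta>)" n] by (simp only: D_def fst_conv snd_conv)
    have le: "schwartz_norm p (\<lambda>t. ?u n t - \<phi> t) \<le> (\<Sum>\<alpha>\<le>p. \<Sum>\<beta>\<le>p. D \<alpha> \<beta>) * inverse (real (Suc n))" for n
    proof -
      have "schwartz_norm p (\<lambda>t. ?u n t - \<phi> t) \<le> (\<Sum>\<alpha>\<le>p. \<Sum>\<beta>\<le>p. D \<alpha> \<beta> / real (Suc n))"
        unfolding diff by (rule schwartz_norm_le) (rule D)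
      then show ?thesis by (simp add: sum_divide_distrib divide_inverse sum_distrib_right)
    qed
    have "(\<lambda>n. (\<Sum>\<alpha>\<le>p. \<Sum>\<beta>\<le>p. D \<alpha> \<beta>) * inverse (real (Suc n))) \<longlonglongrightarrow> (\<Sum>\<alpha>\<le>p. \<Sum>\<beta>\<le>p. D \<alpha> \<beta>) * 0"
      by (intro tendsto_intros LIMSEQ_inverse_real_of_nat)
    then have "(\<lambda>n. (\<Sum>\<alpha>\<le>p. \<Sum>\<beta>\<le>p. D \<alpha> \<beta>) * inverse (real (Suc n))) \<longlonglongrightarrow> 0" by simp
    moreover have "norm (schwartz_norm p (\<lambda>t. ?u n t - \<phi> t)) \<le> (\<Sum>\<alpha>\<le>p. \<Sum>\<beta>\<le>p. D \<alpha> \<beta>) * inverse (real (Suc n))" for n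
    proof -
      have "0 \<le> schwartz_norm p (\<lambda>t. ?u n t - \<phi> t)"
        by (intro schwartz_norm_nonneg schwartz_diff assms subsetD[OF test_functions_subset_schwartz u])
      then show ?thesis using le[of n] by (simp only: real_norm_def abs_of_nonneg)
    qed
    ultimately show ?thesis
      by (rule Lim_null_comparison[OF always_eventually[OF allI], rotated])
  qed
  show ?thesis using u lim by (intro exI[of _ ?u]) auto
qed

lemma tempered_extension_unique:
  assumes T: "T \<in> tempered_distributions" "T' \<in> tempered_distributions"
    and eq: "restrict T test_functions = restrict T' test_functions"
  shows "T = T'"
proof (rule extensionalityI[where A = schwartz_space])
  show "T \<in> extensional schwartz_space" "T' \<in> extensional schwartz_space"
    using T by (auto simp: tempered_distributions_def)
  fix \<phi> assume \<phi>: "\<phi> \<in> schwartz_space"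
  obtain u where u: "\<And>n. u n \<in> test_functions"
    "\<And>p. (\<lambda>n. schwartz_norm p (\<lambda>t. u n t - \<phi> t)) \<longlonglongrightarrow> 0"
    using test_functions_dense[OF \<phi>] by blast
  have u': "u n \<in> schwartz_space" for n using u(1) test_functions_subset_schwartz by blast
  have "T (u n) = T' (u n)" for n using fun_cong[OF eq, of "u n"] u(1) by simp
  then show "T \<phi> = T' \<phi>"
    using tempered_distribution_tendsto[OF T(1) \<phi> u' u(2)]
      tempered_distribution_tendsto[OF T(2) \<phi> u' u(2)] LIMSEQ_unique by simp
qed

lemma tempered_pairing_eqI:
  assumes "T \<in> tempered_distributions" "restrict T test_functions = U"
  shows "tempered_pairing U = T"
  unfolding tempered_pairing_def
  by (rule the_equality) (use assms tempered_extension_unique in auto)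

section \<open>The noise of an integrable path\<close>

lemma schwartz_weighted_le:
  assumes "\<phi> \<in> schwartz_space" "q \<le> p" "\<beta> \<le> p" "0 \<le> t"
  shows "(1 + t) ^ q * \<bar>nderiv \<beta> \<phi> t\<bar> \<le> 2 ^ (q + 1) * schwartz_norm p \<phi>"
proof -
  have "(1 + t) ^ q \<le> (2 * max 1 t) ^ q"
    using assms by (intro power_mono) auto
  also have "\<dots> \<le> 2 ^ q * (t ^ 0 + t ^ q)"
    using assms by (auto simp: power_mult_distrib max_def)
  finally have "(1 + t) ^ q * \<bar>nderiv \<beta> \<phi> t\<bar> \<le> 2 ^ q * (t ^ 0 + t ^ q) * \<bar>nderiv \<beta> \<phi> t\<bar>"
    by (rule mult_right_mono) simp
  also have "\<dots> = 2 ^ q * (\<bar>t ^ 0 * nderiv \<beta> \<phi> t\<bar> + \<bar>t ^ q * nderiv \<beta> \<phi> t\<bar>)"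
    using assms by (simp add: abs_mult algebra_simps)
  also have "\<dots> \<le> 2 ^ q * (schwartz_norm p \<phi> + schwartz_norm p \<phi>)"
    by (intro mult_left_mono add_mono schwartz_le_norm assms) auto
  finally show ?thesis by simp
qed

text \<open>
  The class of paths for which the noise can be integrated against Schwartz functions. It is an
  integrability condition rather than a pointwise growth condition because its constant
  \<open>path_mass\<close> is then a measurable function of a jointly measurable random path.
\<close>

definition weighted_path :: "nat \<Rightarrow> (real \<Rightarrow> real) \<Rightarrow> bool" where
  "weighted_path q x \<longleftrightarrow> set_integrable lborel {0..} (\<lambda>t. x t / (1 + t) ^ q)"

definition path_mass :: "nat \<Rightarrow> (real \<Rightarrow> real) \<Rightarrow> real" where
  "path_mass q x = (LINT t:{0..}|lborel. \<bar>x t / (1 + t) ^ q\<bar>)"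

definition noise :: "(real \<Rightarrow> real) \<Rightarrow> (real \<Rightarrow> real) \<Rightarrow> real" where
  "noise x \<phi> = - (LINT t:{0..}|lborel. x t * deriv \<phi> t)"

lemma path_mass_nonneg: "0 \<le> path_mass q x"
  unfolding path_mass_def set_lebesgue_integral_def by (rule Bochner_Integration.integral_nonneg) auto

lemma weighted_path_integral:
  assumes x: "weighted_path q x" and g: "g \<in> borel_measurable borel"
    and B: "\<And>t. 0 \<le> t \<Longrightarrow> (1 + t) ^ q * \<bar>g t\<bar> \<le> B"
  shows weighted_path_integrable: "set_integrable lborel {0..} (\<lambda>t. x t * g t)"
    and weighted_path_integral_le: "\<bar>LINT t:{0..}|lborel. x t * g t\<bar> \<le> B * path_mass q x"
proof -
  define f where "f t = indicator {0..} t *\<^sub>R (x t / (1 + t) ^ q)" for t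
  define h where "h t = indicator {0..} t * ((1 + t) ^ q * g t)" for t
  have f: "integrable lborel f"
    using x unfolding weighted_path_def set_integrable_def f_def .
  have [measurable]: "g \<in> borel_measurable borel" by (rule g)
  have h: "h \<in> borel_measurable lborel" unfolding h_def by measurable
  have eq: "indicator {0..} t *\<^sub>R (x t * g t) = f t * h t" for t
    by (auto simp: f_def h_def indicator_def)
  have le: "\<bar>f t * h t\<bar> \<le> B * \<bar>f t\<bar>" for t
  proof (cases "0 \<le> t")
    case True
    then have "\<bar>h t\<bar> \<le> B" using B[of t] by (simp add: h_def abs_mult)
    then show ?thesis by (simp add: abs_mult mult.commute[of B] mult_left_mono)
  qed (simp add: f_def)
  have Bf: "integrable lborel (\<lambda>t. B * \<bar>f t\<bar>)" using f by simp
  have fh: "integrable lborel (\<lambda>t. f t * h t)"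
    by (rule Bochner_Integration.integrable_bound[OF Bf])
      (use f h le in \<open>auto intro!: AE_I2 order_trans[OF le abs_ge_self]\<close>)
  then show "set_integrable lborel {0..} (\<lambda>t. x t * g t)"
    unfolding set_integrable_def eq .
  have "\<bar>LINT t|lborel. f t * h t\<bar> \<le> (LINT t|lborel. \<bar>f t * h t\<bar>)" by (rule integral_abs_bound)
  also have "\<dots> \<le> (LINT t|lborel. B * \<bar>f t\<bar>)"
    using fh Bf le by (intro integral_mono) auto
  also have "\<dots> = B * (LINT t|lborel. \<bar>f t\<bar>)" by simp
  also have "(\<lambda>t. \<bar>f t\<bar>) = (\<lambda>t. indicator {0..} t *\<^sub>R \<bar>x t / (1 + t) ^ q\<bar>)"
    by (auto simp: f_def indicator_def)
  finally show "\<bar>LINT t:{0..}|lborel. x t * g t\<bar> \<le> B * path_mass q x"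
    unfolding set_lebesgue_integral_def path_mass_def eq .
qed

lemma smooth_borel: "smooth f \<Longrightarrow> nderiv n f \<in> borel_measurable borel"
  by (intro borel_measurable_continuous_onI smooth_continuous_on)

lemma
  assumes x: "weighted_path q x" and q: "1 \<le> q" and \<phi>: "\<phi> \<in> schwartz_space"
  shows noise_integrable: "set_integrable lborel {0..} (\<lambda>t. x t * deriv \<phi> t)"
    and noise_le: "\<bar>noise x \<phi>\<bar> \<le> 2 ^ (q + 1) * path_mass q x * schwartz_norm q \<phi>"
proof -
  have m: "deriv \<phi> \<in> borel_measurable borel"
    using smooth_borel[of \<phi> 1] \<phi> by (simp add: schwartz_smooth)
  have B: "(1 + t) ^ q * \<bar>deriv \<phi> t\<bar> \<le> 2 ^ (q + 1) * schwartz_norm q \<phi>" if "0 \<le> t" for t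
    using schwartz_weighted_le[OF \<phi> order_refl q that] by simp
  show "set_integrable lborel {0..} (\<lambda>t. x t * deriv \<phi> t)"
    by (rule weighted_path_integrable[OF x m B])
  show "\<bar>noise x \<phi>\<bar> \<le> 2 ^ (q + 1) * path_mass q x * schwartz_norm q \<phi>"
    using weighted_path_integral_le[OF x m B] by (simp add: noise_def algebra_simps)
qed

lemma noise_tempered:
  assumes x: "weighted_path q x" and q: "1 \<le> q"
  shows "restrict (noise x) schwartz_space \<in> tempered_distributions"
proof (rule tempered_distributionI)
  fix \<phi> \<psi> a b assume S: "\<phi> \<in> schwartz_space" "\<psi> \<in> schwartz_space"
  have d: "deriv (\<lambda>t. a * \<phi> t + b * \<psi> t) t = a * deriv \<phi> t + b * deriv \<psi> t" for t
    using nderiv_lincomb[of \<phi> \<psi> 1 a b] S by (simp add: schwartz_smooth)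
  have "(LINT t:{0..}|lborel. x t * deriv (\<lambda>t. a * \<phi> t + b * \<psi> t) t)
      = (LINT t:{0..}|lborel. a * (x t * deriv \<phi> t) + b * (x t * deriv \<psi> t))"
    by (simp add: d algebra_simps)
  also have "\<dots> = a * (LINT t:{0..}|lborel. x t * deriv \<phi> t) + b * (LINT t:{0..}|lborel. x t * deriv \<psi> t)"
    using noise_integrable[OF x q S(1)] noise_integrable[OF x q S(2)] by simp
  finally show "restrict (noise x) schwartz_space (\<lambda>t. a * \<phi> t + b * \<psi> t) =
      a * restrict (noise x) schwartz_space \<phi> + b * restrict (noise x) schwartz_space \<psi>"
    using S by (simp add: schwartz_lincomb noise_def)
next
  fix \<phi> assume "\<phi> \<in> schwartz_space"
  then show "\<bar>restrict (noise x) schwartz_space \<phi>\<bar>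
      \<le> 2 ^ (q + 1) * path_mass q x * schwartz_norm q \<phi>"
    using noise_le[OF x q] by simp
qed simp

definition grid_cell :: "nat \<Rightarrow> nat \<Rightarrow> real set" where
  "grid_cell n i = {real i / real (Suc n)..<(real i + 1) / real (Suc n)}"

text \<open>
  Countably many functionals of a path. They determine the noise of the path, and they do so
  continuously on sets of paths of bounded mass; this is what measurability will rest on.
\<close>

definition cell_integrals :: "(real \<Rightarrow> real) \<Rightarrow> nat \<times> nat \<Rightarrow> real" where
  "cell_integrals x c = (LINT t:{0..}|lborel. x t * indicator (grid_cell (fst c) (snd c)) t)"

definition riemann_noise :: "(real \<Rightarrow> real) \<Rightarrow> nat \<Rightarrow> (nat \<times> nat \<Rightarrow> real) \<Rightarrow> real" where
  "riemann_noise \<phi> n y = - (\<Sum>i<Suc n * Suc n. deriv \<phi> (real i / real (Suc n)) * y (n, i))"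

text \<open>
  The step function samples \<open>\<phi>'\<close> on a grid of mesh \<open>1/m\<close> in \<open>[0, m)\<close> and vanishes beyond, where
  \<open>m = n + 1\<close>. Inside, the mean value theorem bounds the error by \<open>\<bar>\<phi>''\<bar>/m\<close> at a point within
  distance 1 of \<open>t\<close>, so that the weights at the two points are comparable. Outside, one more
  power of \<open>1 + t\<close> is spent on the decay of \<open>\<phi>'\<close>.
\<close>

lemma step_approx:
  fixes \<phi> :: "real \<Rightarrow> real" and n :: nat
  defines "g \<equiv> \<lambda>t. \<Sum>i<Suc n * Suc n. deriv \<phi> (real i / real (Suc n)) * indicator (grid_cell n i) t"
  assumes \<phi>: "\<phi> \<in> schwartz_space" and t: "0 \<le> t"
  shows "(1 + t) ^ q * \<bar>deriv \<phi> t - g t\<bar> \<le> 4 ^ (q + 1) * schwartz_norm (q + 2) \<phi> / real (Suc n)"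
proof -
  define m where "m = real (Suc n)"
  define N where "N = schwartz_norm (q + 2) \<phi>"
  have m: "1 \<le> m" by (simp add: m_def)
  have N: "0 \<le> N" unfolding N_def by (rule schwartz_norm_nonneg[OF \<phi>])
  have four: "(4::real) ^ k = 2 ^ k * 2 ^ k" for k by (simp flip: power_mult_distrib)
  define i where "i = nat \<lfloor>m * t\<rfloor>"
  have i: "real i \<le> m * t" "m * t < real i + 1"
    using t m by (auto simp: i_def)
  have cell: "t \<in> grid_cell n j \<longleftrightarrow> j = i" for j
  proof -
    have "t \<in> grid_cell n j \<longleftrightarrow> real j \<le> m * t \<and> m * t < real j + 1"
      unfolding grid_cell_def m_def[symmetric] using m
      by (simp add: pos_divide_le_eq pos_less_divide_eq mult.commute)
    also have "\<dots> \<longleftrightarrow> j = i" using i by linarith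
    finally show ?thesis .
  qed
  have g: "g t = (if i < Suc n * Suc n then deriv \<phi> (real i / m) else 0)"
  proof -
    have "finite {..<Suc n * Suc n}" by (rule finite_lessThan)
    then show ?thesis
      unfolding g_def indicator_def cell m_def[symmetric] of_bool_def
      by (simp only: mult.right_neutral mult_zero_right if_distrib[of "(*) _"] sum.delta lessThan_iff)
  qed
  show ?thesis
  proof (cases "i < Suc n * Suc n")
    case True
    define s where "s = real i / m"
    have s: "0 \<le> s" "s \<le> t" "t - s \<le> 1 / m"
    proof -
      have "t \<le> (real i + 1) / m" using i m by (simp add: pos_le_divide_eq mult.commute)
      then show "t - s \<le> 1 / m" by (simp add: s_def add_divide_distrib)
    qed (use i m in \<open>auto simp: s_def pos_divide_le_eq mult.commute\<close>)
    show ?thesis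
    proof (cases "s = t")
      case True
      then show ?thesis using g \<open>i < Suc n * Suc n\<close> N by (simp add: s_def[symmetric] N_def)
    next
      case False
      then have "s < t" using s by simp
      obtain z where z: "s < z" "z < t" "deriv \<phi> t - deriv \<phi> s = (t - s) * deriv (deriv \<phi>) z"
        using MVT2[OF \<open>s < t\<close>, of "deriv \<phi>" "deriv (deriv \<phi>)"]
          smooth_DERIV[OF smooth_deriv[OF schwartz_smooth[OF \<phi>]]] by auto
      have "1 / m \<le> 1" using m by simp
      with s(3) have "t - s \<le> 1" by (rule order_trans)
      then have "1 + t \<le> 2 * (1 + z)" using s(1) z(1) by simp
      then have "(1 + t) ^ q \<le> 2 ^ q * (1 + z) ^ q"
        using t power_mono[of "1 + t" "2 * (1 + z)" q, unfolded power_mult_distrib] by simp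
      then have "(1 + t) ^ q * \<bar>deriv \<phi> t - deriv \<phi> s\<bar>
          \<le> (2 ^ q * (1 + z) ^ q) * ((1 / m) * \<bar>deriv (deriv \<phi>) z\<bar>)"
        unfolding z(3) abs_mult using s m z by (intro mult_mono mult_right_mono) auto
      also have "\<dots> = 2 ^ q * ((1 + z) ^ q * \<bar>nderiv 2 \<phi> z\<bar>) / m"
        by (simp add: numeral_2_eq_2)
      also have "\<dots> \<le> 2 ^ q * (2 ^ (q + 1) * N) / m"
        unfolding N_def using s z m
        by (intro divide_right_mono mult_left_mono schwartz_weighted_le \<phi>) auto
      also have "\<dots> \<le> 4 ^ (q + 1) * N / m"
      proof -
        have "2 ^ q * (2 ^ (q + 1) * N) = 4 ^ q * (2 * N)"
          by (simp add: four)
        also have "\<dots> \<le> 4 ^ (q + 1) * N" using N by simp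
        finally show ?thesis using m by (intro divide_right_mono) auto
      qed
      finally show ?thesis using g \<open>i < Suc n * Suc n\<close> by (simp add: s_def m_def N_def)
    qed
  next
    case False
    then have "m * m \<le> real i" unfolding m_def not_less by (simp only: of_nat_mult[symmetric] of_nat_le_iff)
    with i(1) have "m * m \<le> m * t" by (rule order_trans[rotated])
    then have mt: "m \<le> 1 + t" using m by simp
    have "(1 + t) ^ q * \<bar>deriv \<phi> t - g t\<bar> = (1 + t) ^ (q + 1) * \<bar>nderiv 1 \<phi> t\<bar> / (1 + t)"
      using False t by (simp add: g)
    also have "\<dots> \<le> 2 ^ (q + 1 + 1) * N / m"
      unfolding N_def using t m mt N
      by (intro frac_le schwartz_weighted_le \<phi>) (auto simp: N_def)
    also have "\<dots> \<le> 4 ^ (q + 1) * N / m"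
    proof -
      have "(2::real) ^ (q + 1) * 2 \<le> 2 ^ (q + 1) * 2 ^ (q + 1)" by (intro mult_left_mono) auto
      also have "\<dots> = 4 ^ (q + 1)" by (rule four[symmetric])
      finally show ?thesis using m N by (intro divide_right_mono mult_right_mono) auto
    qed
    finally show ?thesis by (simp add: m_def N_def)
  qed
qed

lemma set_integral_sum:
  fixes f :: "'i \<Rightarrow> 'a \<Rightarrow> real"
  assumes "finite I" "\<And>i. i \<in> I \<Longrightarrow> set_integrable M A (f i)"
  shows "set_integrable M A (\<lambda>x. \<Sum>i\<in>I. f i x)"
    and "(LINT x:A|M. (\<Sum>i\<in>I. f i x)) = (\<Sum>i\<in>I. LINT x:A|M. f i x)"
  using assms unfolding set_integrable_def set_lebesgue_integral_def scaleR_sum_right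
  by (simp_all only: Bochner_Integration.integrable_sum Bochner_Integration.integral_sum)

lemma cell_integrable:
  assumes "weighted_path q x"
  shows "set_integrable lborel {0..} (\<lambda>t. x t * indicator (grid_cell n i) t)"
proof (rule weighted_path_integrable[OF assms])
  show "indicator (grid_cell n i) \<in> borel_measurable borel" by (simp add: grid_cell_def)
  fix t :: real assume "0 \<le> t"
  then show "(1 + t) ^ q * \<bar>indicator (grid_cell n i) t\<bar> \<le> (1 + (real i + 1) / real (Suc n)) ^ q"
    by (auto simp: indicator_def grid_cell_def intro!: power_mono)
qed

text \<open>
  The error is a constant depending on \<open>\<phi>\<close> alone times the mass of the path. Hence the convergence
  is uniform on sets of paths of bounded mass.
\<close>

lemma riemann_noise_approx:
  assumes x: "weighted_path q x" and q: "1 \<le> q" and \<phi>: "\<phi> \<in> schwartz_space"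
  shows "\<bar>noise x \<phi> - riemann_noise \<phi> n (cell_integrals x)\<bar>
    \<le> 4 ^ (q + 1) * schwartz_norm (q + 2) \<phi> / real (Suc n) * path_mass q x"
proof -
  define g where "g t = (\<Sum>i<Suc n * Suc n. deriv \<phi> (real i / real (Suc n)) * indicator (grid_cell n i) t)" for t
  have m: "deriv \<phi> \<in> borel_measurable borel"
    using smooth_borel[of \<phi> 1] \<phi> by (simp add: schwartz_smooth)
  have "g \<in> borel_measurable borel" unfolding g_def grid_cell_def by measurable
  then have m': "(\<lambda>t. deriv \<phi> t - g t) \<in> borel_measurable borel" using m by measurable
  have xg: "(\<lambda>t. x t * g t) = (\<lambda>t. \<Sum>i<Suc n * Suc n. deriv \<phi> (real i / real (Suc n)) * (x t * indicator (grid_cell n i) t))"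
    unfolding g_def by (simp only: sum_distrib_left mult_ac)
  have int: "set_integrable lborel {0..} (\<lambda>t. deriv \<phi> (real i / real (Suc n)) * (x t * indicator (grid_cell n i) t))" for i
    using cell_integrable[OF x] by simp
  have ig: "set_integrable lborel {0..} (\<lambda>t. x t * g t)"
    unfolding xg by (intro set_integral_sum(1) int) (rule finite_lessThan)
  have "(LINT t:{0..}|lborel. x t * g t) = (\<Sum>i<Suc n * Suc n. deriv \<phi> (real i / real (Suc n)) * cell_integrals x (n, i))"
    unfolding xg set_integral_sum(2)[OF finite_lessThan int]
    by (simp only: set_integral_mult_right cell_integrals_def fst_conv snd_conv)
  then have "noise x \<phi> - riemann_noise \<phi> n (cell_integrals x) = - (LINT t:{0..}|lborel. x t * (deriv \<phi> t - g t))"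
    using noise_integrable[OF x q \<phi>] ig
    by (simp add: noise_def riemann_noise_def right_diff_distrib)
  then show ?thesis
    using weighted_path_integral_le[OF x m' step_approx[OF \<phi>, of _ q n, folded g_def]] by simp
qed

section \<open>Weak-* measurability of the noise\<close>

lemma topspace_weak_star: "topspace weak_star_topology = tempered_distributions"
  by (auto simp: weak_star_topology_def tempered_distributions_def PiE_UNIV_domain extensional_def PiE_def)

lemma riemann_noise_tendsto:
  assumes "weighted_path q x" "1 \<le> q" "\<phi> \<in> schwartz_space"
  shows "(\<lambda>k. riemann_noise \<phi> k (cell_integrals x)) \<longlonglongrightarrow> noise x \<phi>"
proof -
  define c where "c = 4 ^ (q + 1) * schwartz_norm (q + 2) \<phi> * path_mass q x"
  have "\<bar>riemann_noise \<phi> k (cell_integrals x) - noise x \<phi>\<bar> \<le> c * inverse (real (Suc k))" for k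
    using riemann_noise_approx[OF assms, of k]
    by (simp add: abs_minus_commute c_def divide_inverse mult_ac del: of_nat_Suc)
  moreover have "(\<lambda>k. c * inverse (real (Suc k))) \<longlonglongrightarrow> c * 0"
    by (intro tendsto_intros LIMSEQ_inverse_real_of_nat)
  ultimately have "(\<lambda>k. riemann_noise \<phi> k (cell_integrals x) - noise x \<phi>) \<longlonglongrightarrow> 0"
    using Lim_null_comparison[OF always_eventually,
        of "\<lambda>k. riemann_noise \<phi> k (cell_integrals x) - noise x \<phi>" "\<lambda>k. c * inverse (real (Suc k))"]
    by (simp del: of_nat_Suc)
  then show ?thesis by (rule LIM_zero_cancel)
qed

text \<open>
  On the image of \<open>P\<close> the limit is the noise of the path, written as a function of the cell
  integrals: a uniform limit of finite linear combinations of coordinates.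
\<close>

lemma continuous_on_riemann_limit:
  assumes q: "1 \<le> q" and \<phi>: "\<phi> \<in> schwartz_space"
    and P: "\<And>x. x \<in> P \<Longrightarrow> weighted_path q x \<and> path_mass q x \<le> c"
  shows "continuous_on (cell_integrals ` P) (\<lambda>y. lim (\<lambda>k. riemann_noise \<phi> k y))"
proof (rule uniform_limit_theorem)
  show "\<forall>\<^sub>F k in sequentially. continuous_on (cell_integrals ` P) (riemann_noise \<phi> k)"
    unfolding riemann_noise_def
    by (intro always_eventually allI continuous_intros
        continuous_on_subset[OF continuous_on_product_coordinates]) auto
  define C where "C = 4 ^ (q + 1) * schwartz_norm (q + 2) \<phi>"
  have C: "0 \<le> C" unfolding C_def using schwartz_norm_nonneg[OF \<phi>] by simp
  have lim: "lim (\<lambda>k. riemann_noise \<phi> k (cell_integrals x)) = noise x \<phi>" if "x \<in> P" for x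
    using riemann_noise_tendsto[OF _ q \<phi>] P[OF that] by (intro limI) auto
  have bound: "dist (riemann_noise \<phi> k (cell_integrals x)) (noise x \<phi>) \<le> C * c * inverse (real (Suc k))"
    if "x \<in> P" for x k
  proof -
    have "\<bar>noise x \<phi> - riemann_noise \<phi> k (cell_integrals x)\<bar> \<le> C / real (Suc k) * path_mass q x"
      unfolding C_def using riemann_noise_approx[OF _ q \<phi>] P[OF that] by auto
    also have "\<dots> \<le> C / real (Suc k) * c"
      using C P[OF that] by (intro mult_left_mono) auto
    finally show ?thesis
      by (simp add: dist_real_def abs_minus_commute divide_inverse mult_ac del: of_nat_Suc)
  qed
  have null: "(\<lambda>k. C * c * inverse (real (Suc k))) \<longlonglongrightarrow> C * c * 0"
    by (intro tendsto_intros LIMSEQ_inverse_real_of_nat)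
  show "uniform_limit (cell_integrals ` P) (riemann_noise \<phi>)
      (\<lambda>y. lim (\<lambda>k. riemann_noise \<phi> k y)) sequentially"
  proof (rule uniform_limitI)
    fix e :: real assume "0 < e"
    then have "\<forall>\<^sub>F k in sequentially. C * c * inverse (real (Suc k)) < e"
      by (intro order_tendstoD(2)[OF null]) simp
    then show "\<forall>\<^sub>F k in sequentially. \<forall>y\<in>cell_integrals ` P.
        dist (riemann_noise \<phi> k y) (lim (\<lambda>k. riemann_noise \<phi> k y)) < e"
    proof eventually_elim
      case (elim k)
      then show ?case using lim bound[of _ k] by (fastforce intro: le_less_trans)
    qed
  qed
qed simp

text \<open>
  The Borel sets of the weak-* topology are generated by arbitrary open sets, which need not be
  countable unions of cylinders, so measurability of each pairing is not enough. However, the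
  random vector \<open>J\<close> of cell integrals takes values in a second countable space, and on each event
  where the mass is at most \<open>n\<close> the distribution is a continuous function \<open>F\<close> of \<open>J\<close>. There the
  preimage of an open set is the preimage under \<open>J\<close> of an open set.
\<close>

lemma noise_measurable:
  fixes Y :: "'w \<Rightarrow> real \<Rightarrow> real"
  assumes Y: "(\<lambda>(\<omega>, t). Y \<omega> t) \<in> borel_measurable (M \<Otimes>\<^sub>M lborel)"
    and w: "\<And>\<omega>. \<omega> \<in> space M \<Longrightarrow> weighted_path q (Y \<omega>)" and q: "1 \<le> q"
  shows path_mass_measurable: "(\<lambda>\<omega>. path_mass q (Y \<omega>)) \<in> borel_measurable M"
    and noise_weak_star_measurable:
      "(\<lambda>\<omega>. restrict (noise (Y \<omega>)) schwartz_space) \<in> measurable M weak_star_borel"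
proof -
  have Y' [measurable]: "(\<lambda>c. Y (fst c) (snd c)) \<in> borel_measurable (M \<Otimes>\<^sub>M lborel)"
    using Y by (simp add: case_prod_beta')
  show mass [measurable]: "(\<lambda>\<omega>. path_mass q (Y \<omega>)) \<in> borel_measurable M"
    unfolding path_mass_def set_lebesgue_integral_def
  proof (rule lborel.borel_measurable_lebesgue_integral)
    show "(\<lambda>(\<omega>, t). indicator {0..} t *\<^sub>R \<bar>Y \<omega> t / (1 + t) ^ q\<bar>) \<in> borel_measurable (M \<Otimes>\<^sub>M lborel)"
      unfolding case_prod_beta' by measurable
  qed
  define S where "S \<omega> = restrict (noise (Y \<omega>)) schwartz_space" for \<omega>
  define J where "J \<omega> = cell_integrals (Y \<omega>)" for \<omega>
  have J [measurable]: "J \<in> borel_measurable M"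
  proof (rule measurable_coordinatewise_then_product)
    show "(\<lambda>\<omega>. J \<omega> c) \<in> borel_measurable M" for c
      unfolding J_def cell_integrals_def set_lebesgue_integral_def grid_cell_def
      by (rule lborel.borel_measurable_lebesgue_integral) (unfold case_prod_beta', measurable)
  qed
  have "{\<omega> \<in> space M. path_mass q (Y \<omega>) \<le> real n \<and> S \<omega> \<in> V} \<in> sets M"
    if V: "openin (product_topology (\<lambda>\<phi>. euclideanreal) schwartz_space) V" for V n
  proof -
    define P where "P = Y ` {\<omega> \<in> space M. path_mass q (Y \<omega>) \<le> real n}"
    let ?A = "cell_integrals ` P"
    define F where "F = (\<lambda>y. restrict (\<lambda>\<phi>. lim (\<lambda>k. riemann_noise \<phi> k y)) schwartz_space)"
    have P: "weighted_path q x \<and> path_mass q x \<le> real n" if "x \<in> P" for x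
      using that w by (auto simp: P_def)
    have "continuous_map (top_of_set ?A) (product_topology (\<lambda>\<phi>. euclideanreal) schwartz_space) F"
    proof (rule continuous_map_coordinatewise_then_product)
      fix \<phi> :: "real \<Rightarrow> real" assume "\<phi> \<in> schwartz_space"
      then show "continuous_map (top_of_set ?A) euclideanreal (\<lambda>y. F y \<phi>)"
        using continuous_on_riemann_limit[OF q _ P] by (simp add: F_def)
    qed (simp add: F_def)
    from openin_continuous_map_preimage[OF this V]
    have "openin (top_of_set ?A) {y \<in> ?A. F y \<in> V}" by simp
    then obtain W where W: "open W" "{y \<in> ?A. F y \<in> V} = ?A \<inter> W"
      unfolding openin_open by blast
    have FJ: "F (J \<omega>) = S \<omega>" if "\<omega> \<in> space M" for \<omega>
      unfolding F_def J_def S_def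
      by (intro restrict_ext limI riemann_noise_tendsto[OF w[OF that] q])
    have "{\<omega> \<in> space M. path_mass q (Y \<omega>) \<le> real n \<and> S \<omega> \<in> V}
        = {\<omega> \<in> space M. path_mass q (Y \<omega>) \<le> real n \<and> J \<omega> \<in> W}"
    proof (intro Collect_cong conj_cong refl)
      fix \<omega> assume "\<omega> \<in> space M" "path_mass q (Y \<omega>) \<le> real n"
      then have "J \<omega> \<in> ?A" by (auto simp: J_def P_def)
      then show "S \<omega> \<in> V \<longleftrightarrow> J \<omega> \<in> W"
        using W(2) FJ[OF \<open>\<omega> \<in> space M\<close>] by (metis (no_types, lifting) Int_iff mem_Collect_eq)
    qed
    also have "\<dots> \<in> sets M"
      using borel_open[OF W(1)] by measurable
    finally show ?thesis .
  qed
  note level = this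
  have "S \<in> measurable M weak_star_borel"
    unfolding weak_star_borel_def
  proof (rule measurable_measure_of)
    show "{U. openin weak_star_topology U} \<subseteq> Pow (topspace weak_star_topology)"
      using openin_subset by blast
    show "S \<in> space M \<rightarrow> topspace weak_star_topology"
      using noise_tempered[OF w q] by (simp add: S_def topspace_weak_star)
    fix U assume "U \<in> {U. openin weak_star_topology U}"
    then obtain V where V: "openin (product_topology (\<lambda>\<phi>. euclideanreal) schwartz_space) V"
      and U: "U = V \<inter> tempered_distributions"
      unfolding weak_star_topology_def openin_subtopology by auto
    have "S -` U \<inter> space M = (\<Union>n. {\<omega> \<in> space M. path_mass q (Y \<omega>) \<le> real n \<and> S \<omega> \<in> V})"
      using noise_tempered[OF w q] real_arch_simple by (auto simp: U S_def)
    also have "\<dots> \<in> sets M" using level[OF V] by blast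
    finally show "S -` U \<inter> space M \<in> sets M" .
  qed
  then show "(\<lambda>\<omega>. restrict (noise (Y \<omega>)) schwartz_space) \<in> measurable M weak_star_borel"
    by (simp add: S_def[abs_def])
qed

text \<open>
  The first dyadic of level \<open>m\<close> strictly after \<open>t\<close>: strictness is needed to approach \<open>t\<close> from
  the right, where the paths are continuous.
\<close>

definition dyadic_above :: "nat \<Rightarrow> real \<Rightarrow> real" where
  "dyadic_above m t = (real_of_int \<lfloor>2 ^ m * t\<rfloor> + 1) / 2 ^ m"

lemma dyadic_above_at_right: "filterlim (\<lambda>m. dyadic_above m t) (at_right t) sequentially"
proof -
  have gt: "t < dyadic_above m t" for m
    unfolding dyadic_above_def by (simp add: pos_less_divide_eq mult.commute)
  have le: "dyadic_above m t \<le> t + (1 / 2) ^ m" for m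
  proof -
    have "(t + (1 / 2) ^ m) * 2 ^ m = 2 ^ m * t + 1"
      by (simp add: distrib_right power_one_over)
    moreover have "real_of_int \<lfloor>2 ^ m * t\<rfloor> \<le> 2 ^ m * t" by (rule of_int_floor_le)
    ultimately show ?thesis unfolding dyadic_above_def by (simp add: pos_divide_le_eq)
  qed
  have "(\<lambda>m. t + (1 / 2) ^ m) \<longlonglongrightarrow> t + 0"
    by (intro tendsto_intros LIMSEQ_realpow_zero) auto
  then have "(\<lambda>m. t + (1 / 2) ^ m) \<longlonglongrightarrow> t" by simp
  then have "(\<lambda>m. dyadic_above m t) \<longlonglongrightarrow> t"
    by (rule tendsto_sandwich[OF always_eventually always_eventually tendsto_const, rotated 2])
      (use gt le less_imp_le in auto)
  then show ?thesis
    using gt by (auto simp: filterlim_at less_imp_neq[OF gt, symmetric] intro!: always_eventually)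
qed

text \<open>
  The process is the limit of its right discretisations, each of which takes countably many
  measurable values in time.
\<close>

lemma right_continuous_jointly_measurable:
  fixes Z :: "real \<Rightarrow> 'w \<Rightarrow> real"
  assumes Z: "\<And>t. Z t \<in> borel_measurable M"
    and rc: "\<And>\<omega> t. \<omega> \<in> space M \<Longrightarrow> ((\<lambda>s. Z s \<omega>) \<longlongrightarrow> Z t \<omega>) (at_right t)"
  shows "(\<lambda>(\<omega>, t). Z t \<omega>) \<in> borel_measurable (M \<Otimes>\<^sub>M lborel)"
proof (rule borel_measurable_LIMSEQ_real[where u = "\<lambda>m (\<omega>, t). Z (dyadic_above m t) \<omega>"])
  fix c :: "'w \<times> real" assume "c \<in> space (M \<Otimes>\<^sub>M lborel)"
  then obtain \<omega> t where c: "c = (\<omega>, t)" "\<omega> \<in> space M" by (auto simp: space_pair_measure)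
  from filterlim_compose[OF rc[OF c(2)] dyadic_above_at_right]
  show "(\<lambda>m. (\<lambda>(\<omega>, t). Z (dyadic_above m t) \<omega>) c) \<longlonglongrightarrow> (\<lambda>(\<omega>, t). Z t \<omega>) c"
    by (simp add: c)
next
  fix m :: nat
  have f: "(\<lambda>c. Z ((real_of_int i + 1) / 2 ^ m) (fst c)) \<in> borel_measurable (M \<Otimes>\<^sub>M lborel)" for i
    by (rule measurable_compose[OF measurable_fst Z])
  have g: "(\<lambda>c. \<lfloor>(2::real) ^ m * snd c\<rfloor>) \<in> measurable (M \<Otimes>\<^sub>M lborel) (count_space UNIV)"
    by measurable
  note measurable_compose_countable[where f = "\<lambda>i c. Z ((real_of_int i + 1) / 2 ^ m) (fst c)", OF f g]
  then show "(\<lambda>(\<omega>, t). Z (dyadic_above m t) \<omega>) \<in> borel_measurable (M \<Otimes>\<^sub>M lborel)"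
    by (simp add: case_prod_beta dyadic_above_def)
qed

section \<open>A maximal inequality and boundedness of cadlag paths\<close>

text \<open>
  Ottaviani's maximal inequality. If the walk exceeds \<open>2a\<close>, stop it at the first such index \<open>k\<close>.
  Independently of that event, with probability at least one half the walk moves by at most \<open>a\<close>
  between \<open>k\<close> and \<open>n\<close>, and then it still exceeds \<open>a\<close> at the end. No moments of the
  summands enter, so the inequality is available for moments of any positive order.
\<close>

lemma (in prob_space) ottaviani_inequality:
  fixes Z :: "nat \<Rightarrow> 'a \<Rightarrow> real" and S :: "nat \<Rightarrow> 'a \<Rightarrow> real"
  assumes ind: "indep_vars (\<lambda>_. borel) Z {..<n}"
    and S: "\<And>k \<omega>. S k \<omega> = (\<Sum>i<k. Z i \<omega>)"
    and tail: "\<And>k. k \<le> n \<Longrightarrow> prob {\<omega> \<in> space M. a < \<bar>S n \<omega> - S k \<omega>\<bar>} \<le> 1 / 2"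
  shows "prob {\<omega> \<in> space M. \<exists>k\<le>n. 2 * a < \<bar>S k \<omega>\<bar>} \<le> 2 * prob {\<omega> \<in> space M. a < \<bar>S n \<omega>\<bar>}"
proof -
  have Z: "Z i \<in> borel_measurable M" if "i < n" for i
    using ind that by (simp add: indep_vars_def)
  have S_meas: "S k \<in> borel_measurable M" if "k \<le> n" for k
  proof -
    have "(\<lambda>\<omega>. \<Sum>i<k. Z i \<omega>) \<in> borel_measurable M"
      using that by (intro borel_measurable_sum Z) auto
    then show ?thesis by (simp add: S[abs_def])
  qed
  \<comment> \<open>\<open>E k\<close>: the level \<open>2a\<close> is first exceeded at \<open>k\<close>. \<open>D k\<close>: the walk moves little after \<open>k\<close>.\<close>
  define E where "E k = {\<omega> \<in> space M. 2 * a < \<bar>S k \<omega>\<bar> \<and> (\<forall>j\<in>{..<k}. \<bar>S j \<omega>\<bar> \<le> 2 * a)}" for k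
  define D where "D k = {\<omega> \<in> space M. \<bar>S n \<omega> - S k \<omega>\<bar> \<le> a}" for k
  have E_sets: "E k \<in> sets M" if "k \<le> n" for k
  proof -
    show ?thesis unfolding E_def
    proof (intro sets.sets_Collect_conj sets.sets_Collect_finite_All)
      show "{\<omega> \<in> space M. 2 * a < \<bar>S k \<omega>\<bar>} \<in> sets M"
        using S_meas[OF that] by measurable
      show "{\<omega> \<in> space M. \<bar>S j \<omega>\<bar> \<le> 2 * a} \<in> sets M" if "j \<in> {..<k}" for j
        using S_meas[of j] that \<open>k \<le> n\<close> by simp
    qed auto
  qed
  have D_sets: "D k \<in> sets M" if "k \<le> n" for k
    using S_meas[OF that] S_meas[OF order_refl] unfolding D_def by measurable
  have indep: "prob (E k \<inter> D k) = prob (E k) * prob (D k)" if k: "k \<le> n" for k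
  proof -
    let ?A = "\<lambda>\<omega>. restrict (\<lambda>i. Z i \<omega>) {..<k}" and ?B = "\<lambda>\<omega>. restrict (\<lambda>i. Z i \<omega>) {k..<n}"
    define P where "P = {v \<in> space (PiM {..<k} (\<lambda>_. borel :: real measure)).
      2 * a < \<bar>\<Sum>i<k. v i\<bar> \<and> (\<forall>j\<in>{..<k}. \<bar>\<Sum>i<j. v i\<bar> \<le> 2 * a)}"
    define Q where "Q = {v \<in> space (PiM {k..<n} (\<lambda>_. borel :: real measure)). \<bar>\<Sum>i\<in>{k..<n}. v i\<bar> \<le> a}"
    have var: "indep_var (PiM {..<k} (\<lambda>_. borel)) ?A (PiM {k..<n} (\<lambda>_. borel)) ?B"
      by (rule indep_var_restrict[OF ind]) (use k in auto)
    have partial: "(\<lambda>v. \<Sum>i<j. v i) \<in> borel_measurable (PiM {..<k} (\<lambda>_. borel :: real measure))"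
      if "j \<le> k" for j
      using that by (intro borel_measurable_sum measurable_component_singleton) auto
    have P_sets: "P \<in> sets (PiM {..<k} (\<lambda>_. borel))"
      unfolding P_def
    proof (intro sets.sets_Collect_conj sets.sets_Collect_finite_All)
      show "{v \<in> space (PiM {..<k} (\<lambda>_. borel)). 2 * a < \<bar>\<Sum>i<k. v i\<bar>} \<in> sets (PiM {..<k} (\<lambda>_. borel :: real measure))"
        using partial[OF order_refl] by measurable
      show "{v \<in> space (PiM {..<k} (\<lambda>_. borel)). \<bar>\<Sum>i<j. v i\<bar> \<le> 2 * a} \<in> sets (PiM {..<k} (\<lambda>_. borel :: real measure))"
        if "j \<in> {..<k}" for j
      proof -
        have "j \<le> k" using that by simp
        from partial[OF this] show ?thesis by measurable
      qed
    qed auto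
    have "(\<lambda>v. \<Sum>i\<in>{k..<n}. v i) \<in> borel_measurable (PiM {k..<n} (\<lambda>_. borel :: real measure))"
      by (intro borel_measurable_sum measurable_component_singleton)
    then have Q_sets: "Q \<in> sets (PiM {k..<n} (\<lambda>_. borel))" unfolding Q_def by measurable
    have A: "?A \<omega> \<in> space (PiM {..<k} (\<lambda>_. borel))" and B: "?B \<omega> \<in> space (PiM {k..<n} (\<lambda>_. borel))" for \<omega>
      by (auto simp: space_PiM)
    have split: "S n \<omega> - S k \<omega> = (\<Sum>i\<in>{k..<n}. Z i \<omega>)" for \<omega>
    proof -
      have "(\<Sum>i<n. Z i \<omega>) = (\<Sum>i<k. Z i \<omega>) + (\<Sum>i\<in>{k..<n}. Z i \<omega>)"
        using sum.atLeastLessThan_concat[of 0 k n "\<lambda>i. Z i \<omega>"] k by (simp add: atLeast0LessThan)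
      then show ?thesis by (simp add: S)
    qed
    have EP: "E k = ?A -` P \<inter> space M"
      using A by (auto simp: E_def P_def S)
    have DQ: "D k = ?B -` Q \<inter> space M"
      using B by (auto simp: D_def Q_def split)
    have "E k \<inter> D k = (\<lambda>\<omega>. (?A \<omega>, ?B \<omega>)) -` (P \<times> Q) \<inter> space M" by (auto simp: EP DQ)
    then show ?thesis using indep_varD[OF var P_sets Q_sets] by (simp add: EP DQ)
  qed
  have half: "1 / 2 \<le> prob (D k)" if k: "k \<le> n" for k
  proof -
    have "space M - D k = {\<omega> \<in> space M. a < \<bar>S n \<omega> - S k \<omega>\<bar>}" by (auto simp: D_def)
    then show ?thesis using prob_compl[OF D_sets[OF k]] tail[OF k] by simp
  qed
  have disj: "disjoint_family_on E {..n}"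
  proof -
    have "E j \<inter> E k = {}" if "j < k" for j k
    proof (rule equals0I)
      fix \<omega> assume "\<omega> \<in> E j \<inter> E k"
      then have "2 * a < \<bar>S j \<omega>\<bar>" "\<forall>i\<in>{..<k}. \<bar>S i \<omega>\<bar> \<le> 2 * a" by (auto simp: E_def)
      then show False using that by force
    qed
    then show ?thesis unfolding disjoint_family_on_def by (metis Int_commute linorder_neqE_nat)
  qed
  have U: "{\<omega> \<in> space M. \<exists>k\<le>n. 2 * a < \<bar>S k \<omega>\<bar>} = (\<Union>k\<in>{..n}. E k)"
  proof (intro set_eqI iffI)
    fix \<omega> assume "\<omega> \<in> {\<omega> \<in> space M. \<exists>k\<le>n. 2 * a < \<bar>S k \<omega>\<bar>}"
    then obtain k where k: "\<omega> \<in> space M" "k \<le> n" "2 * a < \<bar>S k \<omega>\<bar>" by auto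
    define j where "j = (LEAST j. 2 * a < \<bar>S j \<omega>\<bar>)"
    have "2 * a < \<bar>S j \<omega>\<bar>" unfolding j_def using k(3) by (rule LeastI)
    moreover have "j \<le> k" unfolding j_def using k(3) by (rule Least_le)
    moreover have "\<bar>S i \<omega>\<bar> \<le> 2 * a" if "i < j" for i
      using not_less_Least[of i "\<lambda>j. 2 * a < \<bar>S j \<omega>\<bar>"] that by (simp add: j_def)
    ultimately show "\<omega> \<in> (\<Union>k\<in>{..n}. E k)" using k by (auto simp: E_def)
  qed (auto simp: E_def)
  have "prob (\<Union>k\<in>{..n}. E k) = (\<Sum>k\<le>n. prob (E k))"
    using disj E_sets by (intro finite_measure_finite_Union) auto
  also have "\<dots> \<le> (\<Sum>k\<le>n. 2 * prob (E k \<inter> D k))"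
  proof (rule sum_mono)
    fix k assume "k \<in> {..n}"
    then show "prob (E k) \<le> 2 * prob (E k \<inter> D k)"
      using half[of k] mult_left_mono[of "1 / 2" "prob (D k)" "prob (E k)"] indep[of k] by simp
  qed
  also have "\<dots> = 2 * prob (\<Union>k\<in>{..n}. E k \<inter> D k)"
  proof -
    have "disjoint_family_on (\<lambda>k. E k \<inter> D k) {..n}"
      using disj by (auto simp: disjoint_family_on_def)
    then have "prob (\<Union>k\<in>{..n}. E k \<inter> D k) = (\<Sum>k\<le>n. prob (E k \<inter> D k))"
      using E_sets D_sets by (intro finite_measure_finite_Union) auto
    then show ?thesis by (simp add: sum_distrib_left)
  qed
  also have "\<dots> \<le> 2 * prob {\<omega> \<in> space M. a < \<bar>S n \<omega>\<bar>}"
  proof -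
    have "(\<Union>k\<in>{..n}. E k \<inter> D k) \<subseteq> {\<omega> \<in> space M. a < \<bar>S n \<omega>\<bar>}" by (auto simp: E_def D_def)
    moreover have "{\<omega> \<in> space M. a < \<bar>S n \<omega>\<bar>} \<in> sets M" using S_meas[OF order_refl] by measurable
    ultimately show ?thesis using finite_measure_mono by simp
  qed
  finally show ?thesis unfolding U .
qed

text \<open>
  One-sided limits give local bounds, and Bolzano's bisection principle glues them. The intersection
  with \<open>{0..}\<close> is there because nothing is known about the path at negative times.
\<close>

lemma cadlag_bounded:
  assumes x: "cadlag x"
  shows "bounded (x ` {0..b})"
proof (cases "0 \<le> b")
  case True
  then have "bounded (x ` ({0..b} \<inter> {0..}))"
  proof (rule Bolzano[where P = "\<lambda>a b. bounded (x ` ({a..b} \<inter> {0..}))"])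
    fix a b c :: real
    assume trans: "bounded (x ` ({a..b} \<inter> {0..}))" "bounded (x ` ({b..c} \<inter> {0..}))"
    have "{a..c} \<inter> {0..} \<subseteq> ({a..b} \<inter> {0..}) \<union> ({b..c} \<inter> {0..})" by auto
    then have "x ` ({a..c} \<inter> {0..}) \<subseteq> x ` ({a..b} \<inter> {0..}) \<union> x ` ({b..c} \<inter> {0..})"
      unfolding image_Un[symmetric] by (rule image_mono)
    moreover have "bounded (x ` ({a..b} \<inter> {0..}) \<union> x ` ({b..c} \<inter> {0..}))"
      using trans by (simp only: bounded_Un)
    ultimately show "bounded (x ` ({a..c} \<inter> {0..}))" by (rule bounded_subset[rotated])
  next
    fix t :: real assume t: "0 \<le> t" "t \<le> b"
    have "(x \<longlongrightarrow> x t) (at_right t)" using x t by (simp add: cadlag_def)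
    then have "\<forall>\<^sub>F s in at_right t. dist (x s) (x t) < 1" by (rule tendstoD) simp
    then obtain u where u: "t < u" "\<And>s. t < s \<Longrightarrow> s < u \<Longrightarrow> dist (x s) (x t) < 1"
      unfolding eventually_at_right_field by blast
    obtain v l where v: "v < t" "\<And>s. v < s \<Longrightarrow> s < t \<Longrightarrow> 0 \<le> s \<Longrightarrow> dist (x s) l < 1"
    proof (cases "t = 0")
      case True
      then show thesis using that[of "-1"] by simp
    next
      case False
      then have "0 < t" using t by simp
      then obtain l where "(x \<longlongrightarrow> l) (at_left t)" using x unfolding cadlag_def by blast
      then have "\<forall>\<^sub>F s in at_left t. dist (x s) l < 1" by (rule tendstoD) simp
      then show thesis unfolding eventually_at_left_field using that by blast
    qed
    let ?d = "min (u - t) (t - v)"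
    have "bounded (x ` ({a..b} \<inter> {0..}))" if "a \<le> t" "t \<le> b" "b - a < ?d" for a b
    proof -
      have "x ` ({a..b} \<inter> {0..}) \<subseteq> ball (x t) 1 \<union> ball l 1"
      proof safe
        fix s assume s: "s \<in> {a..b}" "0 \<le> s" "x s \<notin> ball l 1"
        have "v < s" "s < u" using s that by auto
        then consider "t < s" | "s = t" | "s < t" by linarith
        then show "x s \<in> ball (x t) 1"
          using u(2)[of s] v(2)[of s] s \<open>v < s\<close> \<open>s < u\<close> by cases (auto simp: dist_commute)
      qed
      then show ?thesis by (rule bounded_subset[rotated]) simp
    qed
    moreover have "0 < ?d" using u(1) v(1) by simp
    ultimately show "\<exists>d>0. \<forall>a b. a \<le> t \<and> t \<le> b \<and> b - a < d \<longrightarrow> bounded (x ` ({a..b} \<inter> {0..}))"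
      by blast
  qed
  then show ?thesis by (rule bounded_subset) auto
qed simp

section \<open>Paths of polynomial growth\<close>

text \<open>
  Right continuity passes the bound from dyadic times to all times. For \<open>s < 1\<close> the approximating
  dyadics stay inside the unit interval, so the hypothesis applies to them.
\<close>

lemma cadlag_oscillation_le:
  assumes x: "cadlag x" and s: "0 \<le> s" "s \<le> 1"
    and osc: "\<And>m k. k \<le> 2 ^ m \<Longrightarrow> \<bar>x (real n + real k / 2 ^ m) - x (real n)\<bar> \<le> c"
  shows "\<bar>x (real n + s) - x (real n)\<bar> \<le> c"
proof (cases "s = 1")
  case True
  then show ?thesis using osc[of 1 0] by simp
next
  case False
  define t where "t = real n + s"
  have t: "real n \<le> t" "t < real n + 1" using s False by (auto simp: t_def)
  have "(x \<longlongrightarrow> x t) (at_right t)" using x t unfolding cadlag_def by auto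
  then have lim: "(\<lambda>m. x (dyadic_above m t)) \<longlonglongrightarrow> x t"
    by (rule filterlim_compose[OF _ dyadic_above_at_right])
  have le: "\<bar>x (dyadic_above m t) - x (real n)\<bar> \<le> c" for m
  proof -
    let ?P = "(2::int) ^ m * int n"
    have 1: "?P \<le> \<lfloor>2 ^ m * t\<rfloor>" using t by (simp add: le_floor_iff)
    have 2: "\<lfloor>2 ^ m * t\<rfloor> < ?P + 2 ^ m"
    proof -
      have "2 ^ m * t < 2 ^ m * (real n + 1)" using t by simp
      then have "2 ^ m * t < real_of_int (?P + 2 ^ m)" by (simp add: distrib_left)
      then show ?thesis by (simp only: floor_less_iff)
    qed
    define k where "k = nat (\<lfloor>2 ^ m * t\<rfloor> + 1 - ?P)"
    have rk: "real k = real_of_int \<lfloor>2 ^ m * t\<rfloor> + 1 - 2 ^ m * real n" using 1 by (simp add: k_def)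
    have "real k \<le> 2 ^ m"
    proof -
      have "real_of_int (\<lfloor>2 ^ m * t\<rfloor> + 1) \<le> real_of_int (?P + 2 ^ m)"
        using 2 by (simp only: of_int_le_iff)
      then show ?thesis by (simp add: rk)
    qed
    then have "real k \<le> real (2 ^ m)" by simp
    then have k: "k \<le> 2 ^ m" by (simp only: of_nat_le_iff)
    have "dyadic_above m t = real n + real k / 2 ^ m"
      by (simp add: dyadic_above_def rk field_simps)
    then show ?thesis using osc[OF k] by simp
  qed
  have "(\<lambda>m. \<bar>x (dyadic_above m t) - x (real n)\<bar>) \<longlonglongrightarrow> \<bar>x t - x (real n)\<bar>"
    by (intro tendsto_intros lim)
  then have "\<bar>x t - x (real n)\<bar> \<le> c"
    by (rule LIMSEQ_le_const2) (use le in auto)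
  then show ?thesis by (simp add: t_def)
qed

text \<open>
  Summing the oscillations over the unit intervals up to \<open>n\<close> costs one power of \<open>n\<close>. Up to time
  \<open>n0\<close> the path is merely bounded, and this goes into the random constant.
\<close>

lemma cadlag_polynomial_growth:
  assumes x: "cadlag x"
    and osc: "\<And>n m k. n0 \<le> n \<Longrightarrow> k \<le> 2 ^ m \<Longrightarrow>
      \<bar>x (real n + real k / 2 ^ m) - x (real n)\<bar> \<le> 2 * real (Suc n) ^ r"
  shows "\<exists>C. \<forall>t\<ge>0. \<bar>x t\<bar> \<le> C * (1 + t) ^ Suc r"
proof -
  obtain B where "\<forall>t\<in>{0..real n0}. \<bar>x t\<bar> \<le> B"
    using cadlag_bounded[OF x, of "real n0"] by (auto simp: bounded_iff)
  then have B: "\<bar>x t\<bar> \<le> B" if "0 \<le> t" "t \<le> real n0" for t using that by simp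
  have B0: "0 \<le> B" using B[of 0] by auto
  have unit: "\<bar>x (real n + s) - x (real n)\<bar> \<le> 2 * real (Suc n) ^ r"
    if "n0 \<le> n" "0 \<le> s" "s \<le> 1" for n s
    by (rule cadlag_oscillation_le[OF x that(2,3) osc[OF that(1)]])
  have int: "\<bar>x (real n)\<bar> \<le> B + 2 * real n ^ Suc r" if "n0 \<le> n" for n
    using that
  proof (induction n rule: dec_induct)
    case base
    show ?case using B[of "real n0"] by (simp add: add_increasing2)
  next
    case (step n)
    have "\<bar>x (real (Suc n))\<bar> \<le> \<bar>x (real n)\<bar> + 2 * real (Suc n) ^ r"
      using unit[of n 1] step(1) by (simp add: add.commute)
    also have "\<dots> \<le> B + 2 * (real n * real n ^ r + real (Suc n) ^ r)"
      using step(3) by simp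
    also have "\<dots> \<le> B + 2 * (real n * real (Suc n) ^ r + real (Suc n) ^ r)"
      by (intro add_mono mult_left_mono power_mono) auto
    also have "\<dots> = B + 2 * real (Suc n) ^ Suc r" by (simp add: algebra_simps)
    finally show ?case .
  qed
  have "\<bar>x t\<bar> \<le> (B + 2) * (1 + t) ^ Suc r" if t: "0 \<le> t" for t
  proof -
    have one: "1 \<le> (1 + t) ^ Suc r" using t by (intro one_le_power) auto
    show ?thesis
    proof (cases "t \<le> real n0")
      case True
      have "\<bar>x t\<bar> \<le> (B + 2) * 1" using B[OF t True] by simp
      also have "\<dots> \<le> (B + 2) * (1 + t) ^ Suc r" using one B0 by (intro mult_left_mono) auto
      finally show ?thesis .
    next
      case False
      define n where "n = nat \<lfloor>t\<rfloor>"
      have n: "real n \<le> t" "t < real n + 1" using t by (auto simp: n_def)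
      then have "n0 \<le> n" using False by linarith
      have "\<bar>x t\<bar> \<le> \<bar>x (real n)\<bar> + 2 * real (Suc n) ^ r"
        using unit[OF \<open>n0 \<le> n\<close>, of "t - real n"] n by simp
      also have "\<dots> \<le> B + 2 * (real n * real n ^ r + real (Suc n) ^ r)"
        using int[OF \<open>n0 \<le> n\<close>] by simp
      also have "\<dots> \<le> B + 2 * (t * (1 + t) ^ r + (1 + t) ^ r)"
        using n t by (intro add_mono mult_mono mult_left_mono power_mono) auto
      also have "\<dots> = B * 1 + 2 * (1 + t) ^ Suc r" by (simp add: algebra_simps)
      also have "\<dots> \<le> B * (1 + t) ^ Suc r + 2 * (1 + t) ^ Suc r"
        using one B0 by (intro add_mono mult_left_mono) auto
      finally show ?thesis by (simp add: algebra_simps)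
    qed
  qed
  then show ?thesis by blast
qed

text \<open>
  Two additional powers in the weight make the path integrable against Lebesgue measure.
\<close>

lemma weighted_path_polynomial_growth:
  assumes m: "x \<in> borel_measurable borel" and C: "\<And>t. 0 \<le> t \<Longrightarrow> \<bar>x t\<bar> \<le> C * (1 + t) ^ p"
  shows "weighted_path (p + 2) x"
proof -
  have "set_integrable lborel UNIV (\<lambda>t::real. inverse (1 + t\<^sup>2))"
    using integrable_inverse_1_plus_square by (simp add: einterval_def)
  then have "integrable lborel (\<lambda>t::real. inverse (1 + t\<^sup>2))" by (simp add: set_integrable_def)
  then have i: "integrable lborel (\<lambda>t::real. C * inverse (1 + t\<^sup>2))" by simp
  have C0: "0 \<le> C" using C[of 0] by simp
  have "norm (indicator {0..} t *\<^sub>R (x t / (1 + t) ^ (p + 2))) \<le> norm (C * inverse (1 + t\<^sup>2))" for t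
  proof (cases "0 \<le> t")
    case True
    have "\<bar>x t\<bar> / (1 + t) ^ (p + 2) \<le> C * (1 + t) ^ p / (1 + t) ^ (p + 2)"
      using C[OF True] True by (intro divide_right_mono) auto
    also have "\<dots> = C / (1 + t)\<^sup>2" using True by (simp add: power_add power2_eq_square)
    also have "\<dots> \<le> C / (1 + t\<^sup>2)"
      using True C0 by (intro divide_left_mono mult_pos_pos) (auto simp: power2_sum add_pos_nonneg)
    finally show ?thesis using True C0 by (simp add: divide_inverse abs_mult)
  qed simp
  then show ?thesis
    unfolding weighted_path_def set_integrable_def
    by (intro Bochner_Integration.integrable_bound[OF i]) (use m in auto)
qed

section \<open>Growth of Levy processes\<close>

locale levy = prob_space M for M :: "'w measure" +
  fixes X :: "real \<Rightarrow> 'w \<Rightarrow> real"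
  assumes levy: "levy_process M X"
begin

lemma X_measurable: "0 \<le> t \<Longrightarrow> X t \<in> borel_measurable M"
  using levy by (simp add: levy_process_def)

lemma AE_X0: "AE \<omega> in M. X 0 \<omega> = 0"
  using levy by (simp add: levy_process_def)

lemma AE_cadlag: "AE \<omega> in M. cadlag (\<lambda>t. X t \<omega>)"
  using levy by (simp add: levy_process_def)

lemma increments_indep:
  "0 \<le> t 0 \<Longrightarrow> (\<And>i. i < n \<Longrightarrow> t i < t (Suc i)) \<Longrightarrow>
    indep_vars (\<lambda>_. borel) (\<lambda>i \<omega>. X (t (Suc i)) \<omega> - X (t i) \<omega>) {..<n}"
  for t :: "nat \<Rightarrow> real"
  using levy unfolding levy_process_def by blast

lemma increments_stationary:
  assumes "0 \<le> s" "0 \<le> h"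
  shows "prob {\<omega> \<in> space M. a < \<bar>X (s + h) \<omega> - X s \<omega>\<bar>} = prob {\<omega> \<in> space M. a < \<bar>X h \<omega> - X 0 \<omega>\<bar>}"
proof -
  have d: "distr M borel (\<lambda>\<omega>. X (s + h) \<omega> - X s \<omega>) = distr M borel (\<lambda>\<omega>. X h \<omega> - X 0 \<omega>)"
    using levy assms unfolding levy_process_def by blast
  have m: "(\<lambda>\<omega>. X (s + h) \<omega> - X s \<omega>) \<in> borel_measurable M" "(\<lambda>\<omega>. X h \<omega> - X 0 \<omega>) \<in> borel_measurable M"
    using X_measurable[of "s + h"] X_measurable[of s] X_measurable[of h] X_measurable[of 0] assms by auto
  have A: "{y::real. a < \<bar>y\<bar>} \<in> sets borel" by measurable
  have "measure (distr M borel (\<lambda>\<omega>. X (s + h) \<omega> - X s \<omega>)) {y. a < \<bar>y\<bar>}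
      = measure (distr M borel (\<lambda>\<omega>. X h \<omega> - X 0 \<omega>)) {y. a < \<bar>y\<bar>}" by (simp only: d)
  then show ?thesis
    unfolding measure_distr[OF m(1) A] measure_distr[OF m(2) A]
    by (simp add: vimage_def Int_def conj_commute)
qed

definition dyadic_osc :: "real \<Rightarrow> nat \<Rightarrow> real \<Rightarrow> 'w set" where
  "dyadic_osc u m a = {\<omega> \<in> space M. \<exists>k\<le>2 ^ m. a < \<bar>X (u + real k / 2 ^ m) \<omega> - X u \<omega>\<bar>}"

lemma dyadic_osc_sets:
  assumes "0 \<le> u"
  shows "dyadic_osc u m a \<in> sets M"
proof -
  have "{\<omega> \<in> space M. a < \<bar>X (u + real k / 2 ^ m) \<omega> - X u \<omega>\<bar>} \<in> sets M" for k
  proof -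
    have [measurable]: "X (u + real k / 2 ^ m) \<in> borel_measurable M" "X u \<in> borel_measurable M"
      using assms by (auto intro!: X_measurable)
    show ?thesis by measurable
  qed
  then have "(\<Union>k\<in>{..2 ^ m}. {\<omega> \<in> space M. a < \<bar>X (u + real k / 2 ^ m) \<omega> - X u \<omega>\<bar>}) \<in> sets M"
    by (intro sets.finite_UN) auto
  also have "(\<Union>k\<in>{..2 ^ m}. {\<omega> \<in> space M. a < \<bar>X (u + real k / 2 ^ m) \<omega> - X u \<omega>\<bar>}) = dyadic_osc u m a"
    by (auto simp: dyadic_osc_def)
  finally show ?thesis .
qed

lemma incseq_dyadic_osc: "incseq (\<lambda>m. dyadic_osc u m a)"
proof (rule incseq_SucI, rule subsetI)
  fix m \<omega> assume "\<omega> \<in> dyadic_osc u m a"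
  then obtain k where k: "\<omega> \<in> space M" "k \<le> 2 ^ m" "a < \<bar>X (u + real k / 2 ^ m) \<omega> - X u \<omega>\<bar>"
    by (auto simp: dyadic_osc_def)
  then show "\<omega> \<in> dyadic_osc u (Suc m) a"
    unfolding dyadic_osc_def by (auto intro!: exI[of _ "2 * k"])
qed

text \<open>
  Cadlag paths are bounded on the unit interval, so their supremum is an almost surely finite random
  variable and exceeds a large level with small probability. This supplies the hypothesis of
  Ottaviani's inequality.
\<close>

lemma increments_tight:
  "\<exists>a0. \<forall>a\<ge>a0. \<forall>m. \<forall>k\<le>2 ^ m.
    prob {\<omega> \<in> space M. a < \<bar>X (real k / 2 ^ m) \<omega> - X 0 \<omega>\<bar>} \<le> 1 / 2"
proof -
  define A where "A N = (\<Union>m. dyadic_osc 0 m (real N))" for N :: nat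
  have A_sets: "A N \<in> sets M" for N unfolding A_def using dyadic_osc_sets[of 0] by auto
  have dec: "decseq A"
    unfolding decseq_def A_def dyadic_osc_def by (fastforce intro: order.strict_trans1)
  have "AE \<omega> in M. \<omega> \<notin> (\<Inter>N. A N)"
    using AE_cadlag
  proof eventually_elim
    case (elim \<omega>)
    obtain B where B: "\<forall>t\<in>{0..1}. \<bar>X t \<omega>\<bar> \<le> B"
      using cadlag_bounded[OF elim, of 1] by (auto simp: bounded_iff)
    obtain N :: nat where N: "2 * B \<le> real N" using real_arch_simple by blast
    have "\<bar>X (real k / 2 ^ m) \<omega> - X 0 \<omega>\<bar> \<le> real N" if "k \<le> 2 ^ m" for k m
    proof -
      have "real k \<le> real (2 ^ m)" using that by (simp only: of_nat_le_iff)
      then have "real k / 2 ^ m \<in> {0..1}" by simp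
      then have "\<bar>X (real k / 2 ^ m) \<omega>\<bar> \<le> B" "\<bar>X 0 \<omega>\<bar> \<le> B" using B by auto
      then show ?thesis using N by linarith
    qed
    then have "\<omega> \<notin> A N" by (auto simp: A_def dyadic_osc_def not_less)
    then show ?case by blast
  qed
  then have "prob (\<Inter>N. A N) = 0"
    using A_sets by (subst prob_eq_0) auto
  then have "(\<lambda>N. prob (A N)) \<longlonglongrightarrow> 0"
    using finite_Lim_measure_decseq[OF _ dec] A_sets by auto
  then have "\<forall>\<^sub>F N in sequentially. prob (A N) < 1 / 2"
    by (rule order_tendstoD(2)) simp
  then obtain N where N: "prob (A N) < 1 / 2" by (auto simp: eventually_sequentially)
  show ?thesis
  proof (intro exI[of _ "real N"] allI impI)
    fix a m and k :: nat assume a: "real N \<le> a" and k: "k \<le> 2 ^ m"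
    have "{\<omega> \<in> space M. a < \<bar>X (real k / 2 ^ m) \<omega> - X 0 \<omega>\<bar>} \<subseteq> A N"
    proof safe
      fix \<omega> assume "\<omega> \<in> space M" "a < \<bar>X (real k / 2 ^ m) \<omega> - X 0 \<omega>\<bar>"
      then have "\<omega> \<in> dyadic_osc 0 m (real N)" using a k by (auto simp: dyadic_osc_def)
      then show "\<omega> \<in> A N" by (auto simp: A_def)
    qed
    then have "prob {\<omega> \<in> space M. a < \<bar>X (real k / 2 ^ m) \<omega> - X 0 \<omega>\<bar>} \<le> prob (A N)"
      by (intro finite_measure_mono A_sets)
    then show "prob {\<omega> \<in> space M. a < \<bar>X (real k / 2 ^ m) \<omega> - X 0 \<omega>\<bar>} \<le> 1 / 2"
      using N by simp
  qed
qed

text \<open>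
  Ottaviani's inequality on each dyadic grid, followed by monotone convergence in the level. The
  right-hand side depends neither on the level nor on the starting time \<open>u\<close>.
\<close>

lemma prob_dyadic_osc_le:
  assumes u: "0 \<le> u"
    and tight: "\<And>m k. k \<le> 2 ^ m \<Longrightarrow>
      prob {\<omega> \<in> space M. a < \<bar>X (real k / 2 ^ m) \<omega> - X 0 \<omega>\<bar>} \<le> 1 / 2"
  shows "prob (\<Union>m. dyadic_osc u m (2 * a)) \<le> 2 * prob {\<omega> \<in> space M. a < \<bar>X 1 \<omega> - X 0 \<omega>\<bar>}"
proof -
  have "prob (dyadic_osc u m (2 * a)) \<le> 2 * prob {\<omega> \<in> space M. a < \<bar>X 1 \<omega> - X 0 \<omega>\<bar>}" for m
  proof -
    define t where "t i = u + real i / 2 ^ m" for i :: nat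
    have t0: "t 0 = u" and t1: "t (2 ^ m) = u + 1" by (simp_all add: t_def)
    have "indep_vars (\<lambda>_. borel) (\<lambda>i \<omega>. X (t (Suc i)) \<omega> - X (t i) \<omega>) {..<2 ^ m}"
      using u by (intro increments_indep) (auto simp: t_def divide_strict_right_mono)
    moreover have "X (t k) \<omega> - X u \<omega> = (\<Sum>i<k. X (t (Suc i)) \<omega> - X (t i) \<omega>)" for k \<omega>
      using sum_lessThan_telescope[of "\<lambda>i. X (t i) \<omega>" k] t0 by simp
    moreover have "prob {\<omega> \<in> space M. a < \<bar>(X (t (2 ^ m)) \<omega> - X u \<omega>) - (X (t k) \<omega> - X u \<omega>)\<bar>} \<le> 1 / 2"
      if k: "k \<le> 2 ^ m" for k
    proof -
      have s: "0 \<le> t k" using u by (simp add: t_def)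
      \<comment> \<open>By stationarity the remaining increment is distributed like an initial one of dyadic length.\<close>
      have eq: "t (2 ^ m) = t k + real (2 ^ m - k) / 2 ^ m"
        using k by (simp add: t_def of_nat_diff diff_divide_distrib)
      have "prob {\<omega> \<in> space M. a < \<bar>X (t (2 ^ m)) \<omega> - X (t k) \<omega>\<bar>}
          = prob {\<omega> \<in> space M. a < \<bar>X (real (2 ^ m - k) / 2 ^ m) \<omega> - X 0 \<omega>\<bar>}"
        unfolding eq by (rule increments_stationary[OF s]) simp
      also have "\<dots> \<le> 1 / 2" by (rule tight) simp
      finally show ?thesis by simp
    qed
    ultimately have "prob {\<omega> \<in> space M. \<exists>k\<le>2 ^ m. 2 * a < \<bar>X (t k) \<omega> - X u \<omega>\<bar>}
        \<le> 2 * prob {\<omega> \<in> space M. a < \<bar>X (t (2 ^ m)) \<omega> - X u \<omega>\<bar>}"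
      by (rule ottaviani_inequality)
    also have "prob {\<omega> \<in> space M. a < \<bar>X (t (2 ^ m)) \<omega> - X u \<omega>\<bar>} = prob {\<omega> \<in> space M. a < \<bar>X 1 \<omega> - X 0 \<omega>\<bar>}"
      unfolding t1 using u by (rule increments_stationary) simp
    finally show ?thesis by (simp add: dyadic_osc_def t_def)
  qed
  moreover have "(\<lambda>m. prob (dyadic_osc u m (2 * a))) \<longlonglongrightarrow> prob (\<Union>m. dyadic_osc u m (2 * a))"
    using dyadic_osc_sets[OF u] incseq_dyadic_osc by (intro finite_Lim_measure_incseq) auto
  ultimately show ?thesis by (intro LIMSEQ_le_const2) auto
qed

lemma moment_tail_le:
  assumes \<eta>: "0 < \<eta>" and int: "integrable M (\<lambda>\<omega>. \<bar>X 1 \<omega>\<bar> powr \<eta>)" and a: "0 < a"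
  shows "prob {\<omega> \<in> space M. a < \<bar>X 1 \<omega> - X 0 \<omega>\<bar>} \<le> expectation (\<lambda>\<omega>. \<bar>X 1 \<omega>\<bar> powr \<eta>) / a powr \<eta>"
proof -
  have m: "{\<omega> \<in> space M. a powr \<eta> \<le> \<bar>X 1 \<omega>\<bar> powr \<eta>} \<in> sets M"
    using X_measurable[of 1] by measurable
  have "AE \<omega> in M. \<omega> \<in> {\<omega> \<in> space M. a < \<bar>X 1 \<omega> - X 0 \<omega>\<bar>} \<longrightarrow>
      \<omega> \<in> {\<omega> \<in> space M. a powr \<eta> \<le> \<bar>X 1 \<omega>\<bar> powr \<eta>}"
    using AE_X0
  proof eventually_elim
    case (elim \<omega>)
    then show ?case using a \<eta> by (auto intro!: powr_mono2)
  qed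
  then have "prob {\<omega> \<in> space M. a < \<bar>X 1 \<omega> - X 0 \<omega>\<bar>} \<le> prob {\<omega> \<in> space M. a powr \<eta> \<le> \<bar>X 1 \<omega>\<bar> powr \<eta>}"
    using m by (rule finite_measure_mono_AE)
  also have "\<dots> \<le> expectation (\<lambda>\<omega>. \<bar>X 1 \<omega>\<bar> powr \<eta>) / a powr \<eta>"
    using int a by (intro integral_Markov_inequality_measure[where A = "space M"]) auto
  finally show ?thesis .
qed

text \<open>
  The oscillation over \<open>[n, n + 1]\<close> exceeds \<open>2 (n + 1)\<^sup>r\<close> with probability at most a constant times
  \<open>(n + 1)\<^sup>-\<^sup>r\<^sup>\<eta>\<close>. This is summable once \<open>r \<eta> \<ge> 2\<close>, and the Borel-Cantelli lemma applies.
\<close>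

lemma AE_polynomial_growth:
  assumes \<eta>: "0 < \<eta>" and int: "integrable M (\<lambda>\<omega>. \<bar>X 1 \<omega>\<bar> powr \<eta>)"
  shows "\<exists>p. AE \<omega> in M. \<exists>C. \<forall>t\<ge>0. \<bar>X t \<omega>\<bar> \<le> C * (1 + t) ^ p"
proof -
  obtain a0 where a0: "\<And>a m k. a0 \<le> a \<Longrightarrow> k \<le> 2 ^ m \<Longrightarrow>
    prob {\<omega> \<in> space M. a < \<bar>X (real k / 2 ^ m) \<omega> - X 0 \<omega>\<bar>} \<le> 1 / 2"
    using increments_tight by blast
  define r where "r = nat \<lceil>2 / \<eta>\<rceil>"
  have "2 / \<eta> \<le> real r" using \<eta> by (simp add: r_def real_nat_ceiling_ge)
  then have r: "2 \<le> real r * \<eta>" using \<eta> by (simp add: pos_divide_le_eq)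
  have r1: "1 \<le> r" using r by (cases r) auto
  define c where "c n = real (Suc n) ^ r" for n
  have cn: "real (Suc n) \<le> c n" for n
    using power_increasing[OF r1, of "real (Suc n)"] by (simp add: c_def)
  define K where "K = 2 * expectation (\<lambda>\<omega>. \<bar>X 1 \<omega>\<bar> powr \<eta>)"
  have K: "0 \<le> K" by (simp add: K_def)
  define A where "A n = (\<Union>m. dyadic_osc (real n) m (2 * c n))" for n
  have A_sets: "A n \<in> sets M" for n unfolding A_def using dyadic_osc_sets[of "real n"] by auto
  have bound: "prob (A n) \<le> K * inverse (real (Suc n) ^ 2)" if n: "a0 \<le> real n" for n
  proof -
    have "0 < c n" using cn[of n] by simp
    have "prob (A n) \<le> 2 * prob {\<omega> \<in> space M. c n < \<bar>X 1 \<omega> - X 0 \<omega>\<bar>}"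
      unfolding A_def by (rule prob_dyadic_osc_le) (use a0[of "c n"] cn[of n] n in auto)
    also have "\<dots> \<le> K * inverse (c n powr \<eta>)"
      using moment_tail_le[OF \<eta> int \<open>0 < c n\<close>] by (simp add: K_def divide_inverse)
    also have "\<dots> \<le> K * inverse (real (Suc n) ^ 2)"
    proof (intro mult_left_mono le_imp_inverse_le K)
      have "real (Suc n) ^ 2 = real (Suc n) powr 2" by (simp add: powr_numeral)
      also have "\<dots> \<le> real (Suc n) powr (real r * \<eta>)" using r by (intro powr_mono) auto
      also have "\<dots> = c n powr \<eta>" by (simp add: c_def powr_powr[symmetric] powr_realpow)
      finally show "real (Suc n) ^ 2 \<le> c n powr \<eta>" .
    qed simp
    finally show ?thesis .
  qed
  obtain N :: nat where N: "a0 \<le> real N" using real_arch_simple by blast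
  have "summable (\<lambda>n. inverse (real (Suc n) ^ 2))"
    using inverse_power_summable[of 2, where 'a = real] by (subst summable_Suc_iff) simp
  then have "summable (\<lambda>n. prob (A n))"
    by (rule summable_comparison_test'[OF summable_mult[of _ K], of _ N]) (use bound N in auto)
  then have "AE \<omega> in M. \<forall>\<^sub>F n in sequentially. \<omega> \<in> space M - A n"
    using A_sets by (intro borel_cantelli_AE1) (auto simp: emeasure_eq_measure)
  then have "AE \<omega> in M. \<exists>C. \<forall>t\<ge>0. \<bar>X t \<omega>\<bar> \<le> C * (1 + t) ^ Suc r"
    using AE_cadlag
  proof eventually_elim
    case (elim \<omega>)
    then obtain n0 where n0: "\<And>n. n0 \<le> n \<Longrightarrow> \<omega> \<in> space M - A n"
      by (auto simp: eventually_sequentially)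
    show ?case
    proof (rule cadlag_polynomial_growth[OF elim(2)])
      fix n m k :: nat assume "n0 \<le> n" "k \<le> 2 ^ m"
      then show "\<bar>X (real n + real k / 2 ^ m) \<omega> - X (real n) \<omega>\<bar> \<le> 2 * real (Suc n) ^ r"
        using n0[of n] by (auto simp: A_def dyadic_osc_def c_def not_less)
    qed
  qed
  then show ?thesis by blast
qed

end

section \<open>The noise as a random tempered distribution\<close>

theorem corollary2p11:
  fixes M :: "'w measure" and X :: "real \<Rightarrow> 'w \<Rightarrow> real"
    and \<gamma> \<sigma> \<eta> :: real and \<nu> :: "real measure"
  assumes "prob_space M" and "complete_measure M"
    and "levy_process M X" and "has_characteristic_triplet M X \<gamma> \<sigma> \<nu>"
    and "0 < \<eta>" and "integrable M (\<lambda>\<omega>. \<bar>X 1 \<omega>\<bar> powr \<eta>)"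
  shows "\<exists>S \<in> measurable M weak_star_borel.
    (AE \<omega> in M. is_tempered (levy_white_noise X \<omega>) \<and>
       (\<forall>\<phi>\<in>schwartz_space.
          S \<omega> \<phi> = tempered_pairing (levy_white_noise X \<omega>) \<phi> \<and>
          set_integrable lborel {0..} (\<lambda>t. X t \<omega> * deriv \<phi> t) \<and>
          S \<omega> \<phi> = - (LINT t:{0..}|lborel. X t \<omega> * deriv \<phi> t))) \<and>
    (\<exists>C \<in> borel_measurable M. \<exists>p \<in> measurable M (count_space (UNIV :: nat set)).
       (\<forall>\<omega>\<in>space M. 0 \<le> C \<omega>) \<and>
       (AE \<omega> in M. \<forall>\<phi>\<in>schwartz_space. \<bar>S \<omega> \<phi>\<bar> \<le> C \<omega> * schwartz_norm (p \<omega>) \<phi>))"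
proof -
  interpret levy M X using assms(1,3) by (simp add: levy_def levy_axioms_def)
  obtain p where "AE \<omega> in M. \<exists>C. \<forall>t\<ge>0. \<bar>X t \<omega>\<bar> \<le> C * (1 + t) ^ p"
    using AE_polynomial_growth assms(5,6) by blast
  then have "AE \<omega> in M. cadlag (\<lambda>t. X t \<omega>) \<and> (\<exists>C. \<forall>t\<ge>0. \<bar>X t \<omega>\<bar> \<le> C * (1 + t) ^ p)"
    using AE_cadlag by eventually_elim simp
  then obtain N where N: "N \<in> null_sets M"
    and good: "\<And>\<omega>. \<omega> \<in> space M - N \<Longrightarrow>
      cadlag (\<lambda>t. X t \<omega>) \<and> (\<exists>C. \<forall>t\<ge>0. \<bar>X t \<omega>\<bar> \<le> C * (1 + t) ^ p)"
    by (rule AE_E3) blast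
  \<comment> \<open>The zero path replaces \<open>X\<close> on the null set \<open>N\<close>, so that all paths are right continuous and of
    finite mass, and at negative times, where \<open>X\<close> need not be measurable.\<close>
  define Y where "Y \<omega> t = (if \<omega> \<notin> N \<and> 0 \<le> t then X t \<omega> else 0)" for \<omega> t
  define q where "q = p + 2"
  have q: "1 \<le> q" by (simp add: q_def)
  have Y_t: "(\<lambda>\<omega>. Y \<omega> t) \<in> borel_measurable M" for t
  proof (cases "0 \<le> t")
    case True
    have [measurable]: "N \<in> sets M" using N by auto
    note X_measurable[OF True, measurable]
    show ?thesis unfolding Y_def using True by simp
  qed (simp add: Y_def)
  have Y_meas: "(\<lambda>(\<omega>, t). Y \<omega> t) \<in> borel_measurable (M \<Otimes>\<^sub>M lborel)"
  proof (rule right_continuous_jointly_measurable[of "\<lambda>t \<omega>. Y \<omega> t", OF Y_t])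
    fix \<omega> t assume \<omega>: "\<omega> \<in> space M"
    show "(Y \<omega> \<longlongrightarrow> Y \<omega> t) (at_right t)"
    proof (cases "\<omega> \<notin> N \<and> 0 \<le> t")
      case True
      then have "((\<lambda>t. X t \<omega>) \<longlongrightarrow> X t \<omega>) (at_right t)" using good[of \<omega>] \<omega> by (auto simp: cadlag_def)
      then show ?thesis
        by (rule Lim_transform_eventually[THEN tendsto_eq_rhs])
          (use True in \<open>auto simp: Y_def eventually_at_right_field intro!: exI[of _ "t + 1"]\<close>)
    next
      case False
      show ?thesis
      proof (rule tendsto_eventually)
        show "\<forall>\<^sub>F s in at_right t. Y \<omega> s = Y \<omega> t"
        proof (cases "\<omega> \<in> N")
          case False
          then have "t < 0" using \<open>\<not> (\<omega> \<notin> N \<and> 0 \<le> t)\<close> by simp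
          then show ?thesis by (auto simp: Y_def eventually_at_right_field intro!: exI[of _ 0])
        qed (simp add: Y_def)
      qed
    qed
  qed
  have path: "weighted_path q (Y \<omega>)" if \<omega>: "\<omega> \<in> space M" for \<omega>
  proof -
    from measurable_compose_Pair1[OF \<omega> Y_meas] have m: "Y \<omega> \<in> borel_measurable borel" by simp
    obtain C where C: "\<And>t. 0 \<le> t \<Longrightarrow> \<bar>Y \<omega> t\<bar> \<le> C * (1 + t) ^ p"
    proof (cases "\<omega> \<in> N")
      case True
      then show thesis using that[of 0] by (simp add: Y_def)
    next
      case False
      then obtain C where "\<forall>t\<ge>0. \<bar>X t \<omega>\<bar> \<le> C * (1 + t) ^ p" using good[of \<omega>] \<omega> by blast
      then show thesis using that[of C] False by (simp add: Y_def)
    qed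
    show ?thesis unfolding q_def by (rule weighted_path_polynomial_growth[OF m C])
  qed
  define S where "S \<omega> = restrict (noise (Y \<omega>)) schwartz_space" for \<omega>
  \<comment> \<open>Only the constant is random; the order \<open>q\<close> of the norm depends on \<open>\<eta>\<close> alone.\<close>
  define C where "C \<omega> = 2 ^ (q + 1) * path_mass q (Y \<omega>)" for \<omega>
  have S_meas: "S \<in> measurable M weak_star_borel"
    unfolding S_def[abs_def] by (rule noise_weak_star_measurable[OF Y_meas path q])
  have AE_N: "AE \<omega> in M. \<omega> \<in> space M \<and> \<omega> \<notin> N"
    using AE_not_in[OF N] AE_space by eventually_elim simp
  have tempered: "AE \<omega> in M. is_tempered (levy_white_noise X \<omega>) \<and>
       (\<forall>\<phi>\<in>schwartz_space.
          S \<omega> \<phi> = tempered_pairing (levy_white_noise X \<omega>) \<phi> \<and>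
          set_integrable lborel {0..} (\<lambda>t. X t \<omega> * deriv \<phi> t) \<and>
          S \<omega> \<phi> = - (LINT t:{0..}|lborel. X t \<omega> * deriv \<phi> t))"
    using AE_N
  proof eventually_elim
    case (elim \<omega>)
    have ind: "indicator {0..} t *\<^sub>R (Y \<omega> t * deriv \<phi> t) = indicator {0..} t *\<^sub>R (X t \<omega> * deriv \<phi> t)" for \<phi> t
      using elim by (auto simp: Y_def indicator_def)
    have int: "(LINT t:{0..}|lborel. Y \<omega> t * deriv \<phi> t) = (LINT t:{0..}|lborel. X t \<omega> * deriv \<phi> t)" for \<phi>
      by (simp only: set_lebesgue_integral_def ind)
    have T: "S \<omega> \<in> tempered_distributions"
      unfolding S_def using elim by (intro noise_tempered[OF path q]) simp
    have U: "restrict (S \<omega>) test_functions = levy_white_noise X \<omega>"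
      unfolding levy_white_noise_def S_def noise_def int
      using test_functions_subset_schwartz by (auto simp: fun_eq_iff)
    have "set_integrable lborel {0..} (\<lambda>t. X t \<omega> * deriv \<phi> t)" if "\<phi> \<in> schwartz_space" for \<phi>
      using noise_integrable[OF path[OF conjunct1[OF elim]] q that]
      by (simp only: set_integrable_def ind)
    moreover have "S \<omega> \<phi> = - (LINT t:{0..}|lborel. X t \<omega> * deriv \<phi> t)" if "\<phi> \<in> schwartz_space" for \<phi>
      using that by (simp add: S_def noise_def int)
    ultimately show ?case
      unfolding is_tempered_def tempered_pairing_eqI[OF T U] using T U by blast
  qed
  have C_meas: "C \<in> borel_measurable M"
    unfolding C_def[abs_def] using path_mass_measurable[OF Y_meas path q] by simp
  have bound: "AE \<omega> in M. \<forall>\<phi>\<in>schwartz_space. \<bar>S \<omega> \<phi>\<bar> \<le> C \<omega> * schwartz_norm q \<phi>"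
    using AE_space by eventually_elim (use noise_le[OF path q] in \<open>simp add: S_def C_def\<close>)
  show ?thesis
  proof (intro bexI conjI)
    show "\<forall>\<omega>\<in>space M. 0 \<le> C \<omega>" by (simp add: C_def path_mass_nonneg)
  qed (fact tempered bound S_meas C_meas | simp)+
qed

end
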